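(* Let $\mathcal{H}_A=\mathcal{H}_B=\mathbb{C}^d$ and let $\mathcal{P}=(\mathcal{P}^{\mathrm{yes}},\mathcal{P}^{\mathrm{no}})$ be a property of bipartite pure states in $\mathcal{H}_A\otimes\mathcal{H}_B$ that is unitarily invariant on $\mathcal{H}_B$. Let $0\le s<c\le 1$ and $N\ge 1$. If there exists a (possibly global) $(c,s)$-tester for $\mathcal{P}$ with sample complexity $N$, then there exists a $(c,s)$-tester for $\mathcal{P}$ with sample complexity $N$ that is local on $\mathcal{H}_A$. In particular, whenever $\mathsf{S}_{c,s}(\mathcal{P})$ is finite, some local $(c,s)$-tester on $\mathcal{H}_A$ achieves sample complexity $\mathsf{S}_{c,s}(\mathcal{P})$.
   Context: A property of (mixed) states in $\mathcal{D}(\mathcal{H})$ is a pair $\mathcal{P}=(\mathcal{P}^{\mathrm{yes}},\mathcal{P}^{\mathrm{no}})$ of disjoint subsets of $\mathcal{D}(\mathcal{H})$; it is a property of pure states if both sets consist of pure states. A $(c,s)$-tester for $\mathcal{P}$ with sample complexity $N$ is an operator $\mathcal{T}$ on $\mathcal{H}^{\otimes N}$ with $0\preceq\mathcal{T}\preceq I$ such that $\mathrm{tr}[\mathcal{T}\rho^{\otimes N}]\ge c$ for all $\rho\in\mathcal{P}^{\mathrm{yes}}$ and $\mathrm{tr}[\mathcal{T}\rho^{\otimes N}]\le s$ for all $\rho\in\mathcal{P}^{\mathrm{no}}$. $\mathsf{S}_{c,s}(\mathcal{P})$ denotes the minimum sample complexity over all $(c,s)$-testers for $\mathcal{P}$.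 For $\mathcal{H}=\mathcal{H}_A\otimes\mathcal{H}_B$, a tester on $(\mathcal{H}_A\otimes\mathcal{H}_B)^{\otimes N}\cong\mathcal{H}_A^{\otimes N}\otimes\mathcal{H}_B^{\otimes N}$ is local on $\mathcal{H}_A$ if it has the form $M_A\otimes I_B$ with $0\preceq M_A\preceq I$ acting on $\mathcal{H}_A^{\otimes N}$. A property $\mathcal{P}$ of bipartite states is unitarily invariant on $\mathcal{H}_B$ if for every unitary $U$ on $\mathcal{H}_B$, every $X\in\{\mathrm{yes},\mathrm{no}\}$ and every $\rho\in\mathcal{P}^X$, also $(I_A\otimes U)\rho(I_A\otimes U)^\dagger\in\mathcal{P}^X$. *)

theory Defs
  imports "HOL-Analysis.Analysis"
begin

text \<open>Operators on a finite-dimensional Hilbert space with orthonormal basis indexed by a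
  set S are represented as complex-valued kernels (matrices) S x S. The space C^d is
  indexed by a finite type 'd with CARD('d) = d. The N-fold tensor power of a space
  indexed by 'i is indexed by the lists over 'i of length N.\<close>

definition lists_len :: "nat \<Rightarrow> 'i list set" where
  "lists_len N = {xs. length xs = N}"

definition op_psd :: "'a set \<Rightarrow> ('a \<Rightarrow> 'a \<Rightarrow> complex) \<Rightarrow> bool" where
  "op_psd S T \<longleftrightarrow> (\<forall>v :: 'a \<Rightarrow> complex.
      Im (\<Sum>x\<in>S. \<Sum>y\<in>S. cnj (v x) * T x y * v y) = 0 \<and>
      Re (\<Sum>x\<in>S. \<Sum>y\<in>S. cnj (v x) * T x y * v y) \<ge> 0)"

definition op_between_0_I :: "'a set \<Rightarrow> ('a \<Rightarrow> 'a \<Rightarrow> complex) \<Rightarrow> bool" where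
  "op_between_0_I S T \<longleftrightarrow> op_psd S T \<and> op_psd S (\<lambda>x y. (if x = y then 1 else 0) - T x y)"

definition trace_prod :: "'a set \<Rightarrow> ('a \<Rightarrow> 'a \<Rightarrow> complex) \<Rightarrow> ('a \<Rightarrow> 'a \<Rightarrow> complex) \<Rightarrow> complex" where
  "trace_prod S T R = (\<Sum>x\<in>S. \<Sum>y\<in>S. T x y * R y x)"

definition tensor_pow :: "nat \<Rightarrow> ('i \<Rightarrow> 'i \<Rightarrow> complex) \<Rightarrow> 'i list \<Rightarrow> 'i list \<Rightarrow> complex" where
  "tensor_pow N \<rho> xs ys = (\<Prod>k<N. \<rho> (xs ! k) (ys ! k))"

definition pure_state :: "('i::finite \<Rightarrow> 'i \<Rightarrow> complex) \<Rightarrow> bool" where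
  "pure_state \<rho> \<longleftrightarrow> (\<exists>\<psi> :: 'i \<Rightarrow> complex.
      (\<Sum>i\<in>UNIV. (cmod (\<psi> i))\<^sup>2) = 1 \<and> (\<forall>i j. \<rho> i j = \<psi> i * cnj (\<psi> j)))"

definition pure_property :: "('i::finite \<Rightarrow> 'i \<Rightarrow> complex) set \<Rightarrow> ('i \<Rightarrow> 'i \<Rightarrow> complex) set \<Rightarrow> bool" where
  "pure_property Pyes Pno \<longleftrightarrow> Pyes \<inter> Pno = {} \<and> (\<forall>\<rho>\<in>Pyes \<union> Pno. pure_state \<rho>)"

definition unitary_op :: "('d::finite \<Rightarrow> 'd \<Rightarrow> complex) \<Rightarrow> bool" where
  "unitary_op U \<longleftrightarrow> (\<forall>i j. (\<Sum>k\<in>UNIV. cnj (U k i) * U k j) = (if i = j then 1 else 0))"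

definition conj_B :: "('b::finite \<Rightarrow> 'b \<Rightarrow> complex) \<Rightarrow> ('a \<times> 'b \<Rightarrow> 'a \<times> 'b \<Rightarrow> complex)
    \<Rightarrow> ('a \<times> 'b \<Rightarrow> 'a \<times> 'b \<Rightarrow> complex)" where
  "conj_B U \<rho> = (\<lambda>(a, b) (a', b'). \<Sum>c\<in>UNIV. \<Sum>c'\<in>UNIV. U b c * \<rho> (a, c) (a', c') * cnj (U b' c'))"

definition unitarily_invariant_B ::
  "('a \<times> 'b::finite \<Rightarrow> 'a \<times> 'b \<Rightarrow> complex) set \<Rightarrow> ('a \<times> 'b \<Rightarrow> 'a \<times> 'b \<Rightarrow> complex) set \<Rightarrow> bool" where
  "unitarily_invariant_B Pyes Pno \<longleftrightarrow>
     (\<forall>U. unitary_op U \<longrightarrow> (\<forall>\<rho>\<in>Pyes. conj_B U \<rho> \<in> Pyes) \<and> (\<forall>\<rho>\<in>Pno. conj_B U \<rho> \<in> Pno))"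

definition is_tester :: "real \<Rightarrow> real \<Rightarrow> nat \<Rightarrow> ('i \<Rightarrow> 'i \<Rightarrow> complex) set \<Rightarrow> ('i \<Rightarrow> 'i \<Rightarrow> complex) set
    \<Rightarrow> ('i list \<Rightarrow> 'i list \<Rightarrow> complex) \<Rightarrow> bool" where
  "is_tester c s N Pyes Pno T \<longleftrightarrow>
     op_between_0_I (lists_len N) T \<and>
     (\<forall>\<rho>\<in>Pyes. Re (trace_prod (lists_len N) T (tensor_pow N \<rho>)) \<ge> c) \<and>
     (\<forall>\<rho>\<in>Pno. Re (trace_prod (lists_len N) T (tensor_pow N \<rho>)) \<le> s)"

text \<open>Minimum sample complexity S_{c,s}(P) (meaningful when some tester exists).\<close>
definition sample_complexity :: "real \<Rightarrow> real \<Rightarrow> ('i \<Rightarrow> 'i \<Rightarrow> complex) set \<Rightarrow> ('i \<Rightarrow> 'i \<Rightarrow> complex) set \<Rightarrow> nat" where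
  "sample_complexity c s Pyes Pno = (LEAST N. N \<ge> 1 \<and> (\<exists>T. is_tester c s N Pyes Pno T))"

text \<open>M_A \<otimes> I_B under (H_A \<otimes> H_B)^{\<otimes>N} \<cong> H_A^{\<otimes>N} \<otimes> H_B^{\<otimes>N}.\<close>
definition local_A :: "('a list \<Rightarrow> 'a list \<Rightarrow> complex) \<Rightarrow> ('a \<times> 'b) list \<Rightarrow> ('a \<times> 'b) list \<Rightarrow> complex" where
  "local_A M xs ys = M (map fst xs) (map fst ys) * (if map snd xs = map snd ys then 1 else 0)"

end

theory Submission
  imports Defs
begin

text \<open>A pure state with coefficient matrix \<open>X\<close> is \<open>(X \<otimes> I) \<Omega>\<close> with \<open>\<Omega>\<close> the unnormalised maximally entangled
  vector. By invariance, \<open>\<Omega>\<Omega>\<^sup>*\<close> on \<open>N\<close> copies may be replaced by a positive kernel \<open>W\<close>, a twirl of it, without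
  spoiling the tester, such that \<open>W\<close> commutes with \<open>V \<otimes> I\<close> for every \<open>N\<close>-fold tensor power \<open>V\<close> of a unitary and has
  partial trace \<open>I\<close>. Unitaries are Zariski dense, so \<open>W\<close>, and hence its square root \<open>R\<close>, commutes with
  \<open>Y \<otimes> I\<close> where \<open>Y\<close> is the \<open>N\<close>-fold tensor power of any matrix \<open>X\<close>. Therefore the acceptance probability \<open>tr (T Y W Y\<^sup>*)\<close> equals
  \<open>tr (R T R (Y Y\<^sup>* \<otimes> I))\<close>, and \<open>M = tr\<^sub>B (R T R)\<close> is a local tester with \<open>0 \<le> M \<le> tr\<^sub>B W = I\<close>.\<close>

section \<open>Kernels and unitaries\<close>

text \<open>Invariance on the second factor becomes conjugation on the first through the transpose
  rule \<open>(V \<otimes> I) \<Omega> = (I \<otimes> V\<^sup>T) \<Omega>\<close>: applying the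
  transpose of \<open>V\<close> to B turns the coefficient matrix \<open>X\<close> into
  \<open>X V\<close>, so a kernel that stands in for the maximally entangled one may be conjugated
  by the tensor power of \<open>V\<close> on A. The obstacle is that coefficient matrices are
  arbitrary, often singular, while invariance speaks of unitaries only. Commutation is a polynomial
  identity in the entries of the matrix, which is why density bridges the gap. Splitting
  \<open>W\<close> as \<open>R R\<close> is what bounds \<open>M\<close>: \<open>R T R\<close> is
  positive and lies below \<open>R R\<close> because \<open>T\<close> lies below \<open>I\<close>,
  whereas \<open>T W\<close> need not even be Hermitian. \<open>W\<close> is not written as an
  integral: it is the element of least norm among all kernels sharing the relevant properties of the
  maximally entangled one, and uniqueness of that element yields the commutation.\<close>

definition kmul :: "'b set \<Rightarrow> ('a \<Rightarrow> 'b \<Rightarrow> complex) \<Rightarrow> ('b \<Rightarrow> 'c \<Rightarrow> complex) \<Rightarrow> 'a \<Rightarrow> 'c \<Rightarrow> complex" where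
  "kmul S A B = (\<lambda>x z. \<Sum>y\<in>S. A x y * B y z)"

definition kadj :: "('a \<Rightarrow> 'b \<Rightarrow> complex) \<Rightarrow> 'b \<Rightarrow> 'a \<Rightarrow> complex" where
  "kadj A = (\<lambda>x y. cnj (A y x))"

definition kone :: "'a set \<Rightarrow> 'a \<Rightarrow> 'a \<Rightarrow> complex" where
  "kone S = (\<lambda>x y. if x = y \<and> x \<in> S then 1 else 0)"

text \<open>Kernels are total functions while operators live on \<open>S\<close> only. Vanishing off
  \<open>S\<close> lets identities such as \<open>kmul S (kone S) A = A\<close> hold as equations of
  functions.\<close>

definition ksupp :: "'a set \<Rightarrow> ('a \<Rightarrow> 'a \<Rightarrow> complex) \<Rightarrow> bool" where
  "ksupp S A \<longleftrightarrow> (\<forall>x y. x \<notin> S \<or> y \<notin> S \<longrightarrow> A x y = 0)"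

definition ktrace :: "'a set \<Rightarrow> ('a \<Rightarrow> 'a \<Rightarrow> complex) \<Rightarrow> complex" where
  "ktrace S A = (\<Sum>x\<in>S. A x x)"

lemma kmul_assoc: "kmul S (kmul T A B) C = kmul T A (kmul S B C)"
  unfolding kmul_def
  by (intro ext, simp add: sum_distrib_left sum_distrib_right mult.assoc, rule sum.swap)

lemma kadj_kmul: "kadj (kmul S A B) = kmul S (kadj B) (kadj A)"
  by (simp add: kmul_def kadj_def mult.commute)

lemma kadj_kadj [simp]: "kadj (kadj A) = A"
  by (simp add: kadj_def)

lemma kadj_kone [simp]: "kadj (kone S) = kone S"
  by (auto simp: kadj_def kone_def fun_eq_iff)

lemma ksupp_kone [simp]: "ksupp S (kone S)"
  by (auto simp: ksupp_def kone_def)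

lemma ksupp_kadj [simp]: "ksupp S (kadj A) \<longleftrightarrow> ksupp S A"
  by (auto simp: ksupp_def kadj_def)

lemma ksupp_kmul: "ksupp S A \<Longrightarrow> ksupp S B \<Longrightarrow> ksupp S (kmul T A B)"
  unfolding ksupp_def kmul_def by (auto intro!: sum.neutral)

lemma kmul_kone_left: "finite S \<Longrightarrow> ksupp S A \<Longrightarrow> kmul S (kone S) A = A"
proof (intro ext)
  fix x z assume "finite S" "ksupp S A"
  thus "kmul S (kone S) A x z = A x z"
    by (cases "x \<in> S")
      (simp_all add: kmul_def kone_def ksupp_def if_distrib[of "\<lambda>x. x * _"] cong: if_cong)
qed

lemma kmul_kone_right:
  assumes "finite S" "ksupp S A" shows "kmul S A (kone S) = A"
  using arg_cong[OF kmul_kone_left[of S "kadj A"], of kadj] assms by (simp add: kadj_kmul)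

lemma ktrace_cyclic: "ktrace S (kmul T A B) = ktrace T (kmul S B A)"
  unfolding ktrace_def kmul_def by (subst sum.swap) (simp add: mult.commute)

section \<open>Unitary kernels and their Zariski density\<close>

text \<open>Both products are recorded: \<open>V\<^sup>* V = I\<close> makes conjugation preserve
  the norm, \<open>V V\<^sup>* = I\<close> makes it preserve a partial trace equal to
  \<open>I\<close>.\<close>

definition kunitary :: "('d::finite \<Rightarrow> 'd \<Rightarrow> complex) \<Rightarrow> bool" where
  "kunitary V \<longleftrightarrow> kmul UNIV (kadj V) V = kone UNIV \<and> kmul UNIV V (kadj V) = kone UNIV"

text \<open>For \<open>n = |v|\<^sup>2\<close>, multiplying \<open>I + w v v\<^sup>*\<close> by its
  adjoint gives \<open>I + z v v\<^sup>*\<close> with \<open>z = w + cnj w + w cnj w n\<close>, and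
  \<open>n z = |1 + w n|\<^sup>2 - 1\<close>.\<close>

lemma kunitary_reflection:
  fixes v :: "'d::finite \<Rightarrow> complex"
  assumes w: "cmod (1 + w * of_real (\<Sum>i\<in>UNIV. (cmod (v i))\<^sup>2)) = 1"
    and v: "(\<Sum>i\<in>UNIV. (cmod (v i))\<^sup>2) \<noteq> 0"
  shows "kunitary (\<lambda>i j. kone UNIV i j + w * (v i * cnj (v j)))"
proof -
  define n where "n = (\<Sum>i\<in>UNIV. (cmod (v i))\<^sup>2)"
  have n: "complex_of_real n = (\<Sum>i\<in>UNIV. v i * cnj (v i))"
    unfolding n_def by (simp only: of_real_sum complex_norm_square)
  have "n * (2 * Re w + n * ((Re w)\<^sup>2 + (Im w)\<^sup>2)) = 0"
    using w unfolding n_def[symmetric]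
    by (simp add: cmod_def power2_eq_square algebra_simps)
  hence "2 * Re w + n * ((Re w)\<^sup>2 + (Im w)\<^sup>2) = 0"
    using v n_def by simp
  hence z: "w + cnj w + w * cnj w * of_real n = 0"
    by (simp add: complex_eq_iff power2_eq_square algebra_simps)
  hence z': "cnj w + w + cnj w * w * of_real n = 0"
    by (simp add: ac_simps)
  have gen: "(\<Sum>k\<in>UNIV. (kone UNIV i k + a * (v i * cnj (v k))) * (kone UNIV k j + b * (v k * cnj (v j))))
      = kone UNIV i j + (a + b + a * b * of_real n) * (v i * cnj (v j))" for a b i j
  proof -
    have "(\<Sum>k\<in>UNIV. (kone UNIV i k + a * (v i * cnj (v k))) * (kone UNIV k j + b * (v k * cnj (v j))))
     = (\<Sum>k\<in>UNIV. kone UNIV i k * kone UNIV k j) + (\<Sum>k\<in>UNIV. kone UNIV i k * (b * (v k * cnj (v j))))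
      + (\<Sum>k\<in>UNIV. a * (v i * cnj (v k)) * kone UNIV k j) + (\<Sum>k\<in>UNIV. (v k * cnj (v k)) * (a * b * v i * cnj (v j)))"
      by (simp add: sum.distrib algebra_simps)
    also have "\<dots> = kone UNIV i j + b * (v i * cnj (v j)) + a * (v i * cnj (v j)) + of_real n * (a * b * v i * cnj (v j))"
      unfolding n sum_distrib_right[symmetric]
      by (simp add: kone_def if_distrib[of "\<lambda>x. x * _"] if_distrib[of "\<lambda>x. _ * x"] cong: if_cong)
    finally show ?thesis by (simp add: algebra_simps)
  qed
  have adj: "kadj (\<lambda>i j. kone UNIV i j + w * (v i * cnj (v j))) = (\<lambda>i j. kone UNIV i j + cnj w * (v i * cnj (v j)))"
    by (auto simp: kadj_def kone_def fun_eq_iff)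
  show ?thesis
    unfolding kunitary_def adj kmul_def gen z z' by simp
qed

text \<open>The set is a circle with centre \<open>-1/n\<close>; the arc on which
  \<open>1 + w n\<close> has real part \<open>t\<close> between 0 and 1 is already infinite. This
  feeds the rule \<open>line\<close> with unitary points.\<close>

lemma infinite_circle: 
  assumes "n \<noteq> (0::real)" shows "infinite {w. cmod (1 + w * of_real n) = 1}"
proof
  assume fin: "finite {w. cmod (1 + w * of_real n) = 1}"
  have "infinite {0<..<(1::real)}" by simp
  moreover have "(\<lambda>t. (Complex t (sqrt (1 - t\<^sup>2)) - 1) / of_real n) ` {0<..<1} \<subseteq> {w. cmod (1 + w * of_real n) = 1}"
    using assms by (auto simp: cmod_def power_le_one)
  moreover have "inj_on (\<lambda>t. (Complex t (sqrt (1 - t\<^sup>2)) - 1) / of_real n) {0<..<1}"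
    using assms by (auto simp: inj_on_def complex_eq_iff)
  ultimately show False
    using fin by (meson finite_imageD finite_subset)
qed

lemma kmul_diag:
  fixes a :: "'d::finite \<Rightarrow> complex"
  shows "kmul UNIV (\<lambda>i j. if i = j then a i else 0) A = (\<lambda>i j. a i * A i j)"
    "kmul UNIV A (\<lambda>i j. if i = j then a i else 0) = (\<lambda>i j. A i j * a j)"
  by (simp_all add: kmul_def fun_eq_iff if_distrib[of "\<lambda>x. x * _"] if_distrib[of "\<lambda>x. _ * x"] cong: if_cong)

text \<open>Zariski density of the unitary group: every polynomial condition satisfies the rule \<open>line\<close>.\<close>

lemma unitary_dense_induct [case_names mult unitary line]:
  fixes P :: "('d::finite \<Rightarrow> 'd \<Rightarrow> complex) \<Rightarrow> bool"
  assumes mult: "\<And>A B. P A \<Longrightarrow> P B \<Longrightarrow> P (kmul UNIV A B)"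
    and unitary: "\<And>V. kunitary V \<Longrightarrow> P V"
    and line: "\<And>A B w. infinite {w. P (\<lambda>i j. A i j + w * B i j)} \<Longrightarrow> P (\<lambda>i j. A i j + w * B i j)"
  shows "P X"
proof -
  have one: "P (kone UNIV)"
    by (rule unitary) (simp add: kunitary_def kmul_kone_left)
  \<comment> \<open>The unitary points of this line in \<open>w\<close> form a circle, so
    \<open>line\<close> extends \<open>P\<close> to every complex \<open>w\<close>.\<close>
  have refl: "P (\<lambda>i j. kone UNIV i j + w * (v i * cnj (v j)))" for w v
  proof (cases "(\<Sum>i\<in>UNIV. (cmod (v i))\<^sup>2) = 0")
    case True
    hence "v i = 0" for i by (simp add: sum_nonneg_eq_0_iff)
    thus ?thesis using one by (simp add: kone_def)
  next
    case False
    show ?thesis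
      by (rule line, rule infinite_super[OF _ infinite_circle[OF False]])
        (blast intro: unitary kunitary_reflection[OF _ False])
  qed
  \<comment> \<open>One diagonal entry is set at a time, by the factor
    \<open>I + (a k - 1) e e\<^sup>*\<close> with \<open>e\<close> the basis vector at
    \<open>k\<close>.\<close>
  have diag: "P (\<lambda>i j. if i = j then a i else 0)" for a
  proof -
    have "P (\<lambda>i j. if i = j then (if i \<in> F then a i else 1) else 0)" if "finite F" for F
      using that
    proof induct
      case empty
      show ?case using one by (simp add: kone_def cong: if_cong)
    next
      case (insert k F)
      have "P (kmul UNIV (\<lambda>i j. if i = j then (if i \<in> F then a i else 1) else 0)
          (\<lambda>i j. kone UNIV i j + (a k - 1) * (of_bool (i = k) * cnj (of_bool (j = k)))))"
        by (intro mult insert refl)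
      also have "kmul UNIV (\<lambda>i j. if i = j then (if i \<in> F then a i else 1) else 0)
          (\<lambda>i j. kone UNIV i j + (a k - 1) * (of_bool (i = k) * cnj (of_bool (j = k))))
         = (\<lambda>i j. if i = j then (if i \<in> insert k F then a i else 1) else 0)"
        unfolding kmul_diag using insert(2) by (auto simp: fun_eq_iff kone_def)
      finally show ?case .
    qed
    from this[of UNIV] show ?thesis by (simp cong: if_cong)
  qed
  \<comment> \<open>A transposition is the reflection \<open>I - u u\<^sup>*\<close> with
    \<open>u\<close> the difference of two basis vectors.\<close>
  have swap: "P (\<lambda>i j. of_bool (i = Transposition.transpose m n j))" if "m \<noteq> n" for m n
  proof -
    have "(\<lambda>i j. of_bool (i = Transposition.transpose m n j))
      = (\<lambda>i j. kone UNIV i j + (-1) * ((of_bool (i = m) - of_bool (i = n)) * cnj (of_bool (j = m) - of_bool (j = n))))"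
      using that by (auto simp: fun_eq_iff kone_def Transposition.transpose_def)
    thus ?thesis by (simp only: refl)
  qed
  \<comment> \<open>A transvection is not of the form \<open>I + w v v\<^sup>*\<close>. It is
    reached at \<open>w = 0\<close> on a line: for \<open>v = e\<^sub>m + r e\<^sub>n\<close>,
    scaling \<open>I + v v\<^sup>*\<close> by diagonal matrices on both sides gives exactly
    \<open>A + r\<^sup>2 B\<close>, and \<open>B\<close> collects the entries that disappear with
    \<open>r\<close>.\<close>
  have trans: "P (\<lambda>i j. of_bool (i = n \<and> j = m \<or> i = j))" if mn: "m \<noteq> n" for m n
  proof -
    define A :: "'d \<Rightarrow> 'd \<Rightarrow> complex" where "A = (\<lambda>i j. of_bool (i = n \<and> j = m \<or> i = j))"
    define B :: "'d \<Rightarrow> 'd \<Rightarrow> complex" where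
      "B = (\<lambda>i j. if j = n \<and> i = m then 1/2 else if j = n \<and> i = n then 1 else 0)"
    have pos: "P (\<lambda>i j. A i j + of_real (r^2) * B i j)" if "r > 0" for r :: real
    proof -
      define v :: "'d \<Rightarrow> complex" where "v = (\<lambda>i. if i = m then 1 else if i = n then of_real r else 0)"
      have "P (kmul UNIV (\<lambda>i j. if i = j then (\<lambda>i. if i = n then of_real (2/r) else 1) i else 0)
         (kmul UNIV (\<lambda>i j. kone UNIV i j + 1 * (v i * cnj (v j)))
         (\<lambda>i j. if i = j then (\<lambda>i. if i = n then of_real (r/2) else if i = m then 1/2 else 1) i else 0)))"
        by (intro mult diag refl)
      also have "kmul UNIV (\<lambda>i j. if i = j then (\<lambda>i. if i = n then of_real (2/r) else 1) i else 0)
         (kmul UNIV (\<lambda>i j. kone UNIV i j + 1 * (v i * cnj (v j)))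
         (\<lambda>i j. if i = j then (\<lambda>i. if i = n then of_real (r/2) else if i = m then 1/2 else 1) i else 0))
         = (\<lambda>i j. A i j + of_real (r^2) * B i j)"
        unfolding kmul_diag using that mn 
        by (auto simp: fun_eq_iff kone_def A_def B_def v_def power2_eq_square field_simps)
      finally show ?thesis .
    qed
    have "inj_on (\<lambda>r. complex_of_real (r^2)) {0<..}"
      by (auto simp: inj_on_def simp del: of_real_power)
    hence "infinite ((\<lambda>r. complex_of_real (r^2)) ` {0<..})"
      using finite_imageD infinite_Ioi by blast
    hence "infinite {w. P (\<lambda>i j. A i j + w * B i j)}"
      by (rule infinite_super[rotated]) (use pos in auto)
    from line[OF this, of 0] show ?thesis by (simp add: A_def)
  qed
  \<comment> \<open>The guard on the determinant makes the zero-row case of the elementary-matrix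
    induction vacuous; singular matrices are reached afterwards along a line.\<close>
  have nonsing: "det A \<noteq> 0 \<longrightarrow> P (\<lambda>i j. of_real (A $ i $ j))" for A :: "real^'d^'d"
  proof (induction A rule: induct_matrix_elementary_alt)
    case (1 A B)
    have "(\<lambda>i j. complex_of_real ((A ** B) $ i $ j)) =
       kmul UNIV (\<lambda>i j. of_real (A $ i $ j)) (\<lambda>i j. of_real (B $ i $ j))"
      by (simp add: kmul_def matrix_matrix_mult_def)
    thus ?case using 1 assms(1) by (auto simp: det_mul)
  next
    case (2 A i)
    thus ?case by (simp add: det_zero_row)
  next
    case (3 A)
    have "(\<lambda>i j. complex_of_real (A $ i $ j)) = (\<lambda>i j. if i = j then of_real (A $ i $ i) else 0)"
      using 3 by (auto simp: fun_eq_iff)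
    thus ?case using diag[of "\<lambda>i. of_real (A $ i $ i)"] by simp
  next
    case (4 m n)
    have "(\<lambda>i j. complex_of_real ((\<chi> i j. mat 1 $ i $ Transposition.transpose m n j) $ i $ j))
       = (\<lambda>i j. of_bool (i = Transposition.transpose m n j))"
      by (auto simp: fun_eq_iff mat_def)
    thus ?case using swap[OF 4] by simp
  next
    case (5 m n)
    hence "n \<noteq> m" by simp
    from trans[OF this] show ?case
      by (simp add: of_bool_def if_distrib[of complex_of_real] cong: if_cong del: of_bool_or_iff)
  qed
  have real: "P (\<lambda>i j. complex_of_real (X i j))" for X
  proof -
    \<comment> \<open>The line runs from the identity at \<open>s = 0\<close> to \<open>X\<close> at
      \<open>s = 1\<close>. Near 0 it consists of invertible matrices, which is enough for
      \<open>line\<close> to reach \<open>X\<close>.\<close>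
    define D where "D = (\<lambda>s::real. \<chi> i j. (if i = j then 1 else 0) + s * (X i j - (if i = j then 1 else 0)) :: real^'d^'d)"
    have "isCont (\<lambda>s. det (D s)) 0"
      unfolding det_def D_def by (simp, intro continuous_intros)
    moreover have "det (D 0) = 1"
      using det_I by (simp add: D_def mat_def)
    ultimately obtain e where e: "e > 0" "\<And>s. dist 0 s < e \<Longrightarrow> det (D s) \<noteq> 0"
      using continuous_at_avoid[of 0 "\<lambda>s. det (D s)" 0] by auto
    have "infinite (complex_of_real ` {0<..<e})"
      using e(1) by (subst finite_image_iff) (auto simp: inj_on_def)
    moreover have "complex_of_real ` {0<..<e} \<subseteq>
      {w. P (\<lambda>i j. (if i = j then 1 else 0) + w * (of_real (X i j) - (if i = j then 1 else 0)))}"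
    proof safe
      fix s :: real assume s: "s \<in> {0<..<e}"
      have "(\<lambda>i j. complex_of_real (D s $ i $ j)) = (\<lambda>i j. (if i = j then 1 else 0) + of_real s * (of_real (X i j) - (if i = j then 1 else 0)))"
        by (auto simp: D_def fun_eq_iff)
      moreover have "P (\<lambda>i j. complex_of_real (D s $ i $ j))"
        using nonsing e(2)[of s] s by (auto simp: dist_norm)
      ultimately show "P (\<lambda>i j. (if i = j then 1 else 0) + of_real s * (of_real (X i j) - (if i = j then 1 else 0)))"
        by simp
    qed
    ultimately have "infinite {w. P (\<lambda>i j. (if i = j then 1 else 0) + w * (of_real (X i j) - (if i = j then 1 else 0)))}"
      using infinite_super by blast
    from line[OF this, of 1] show ?thesis by simp
  qed
  \<comment> \<open>Real parameters give real matrices on the line \<open>Re X + w Im X\<close>; the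
    complex matrix \<open>X\<close> sits at \<open>w = \<i>\<close>.\<close>
  have "P (\<lambda>i j. of_real (Re (X i j)) + of_real t * of_real (Im (X i j)))" for t
    using real[of "\<lambda>i j. Re (X i j) + t * Im (X i j)"] by simp
  hence "range complex_of_real \<subseteq> {w. P (\<lambda>i j. of_real (Re (X i j)) + w * of_real (Im (X i j)))}"
    by blast
  moreover have "infinite (range complex_of_real)"
    using infinite_UNIV_char_0 by (simp add: finite_image_iff inj_of_real)
  ultimately have "infinite {w. P (\<lambda>i j. of_real (Re (X i j)) + w * of_real (Im (X i j)))}"
    by (rule infinite_super)
  from line[OF this, of \<i>] show ?thesis by (simp flip: complex_eq)
qed

section \<open>Square roots and norm minimisers\<close>

text \<open>Taylor coefficients of \<open>sqrt (1 - x)\<close> at 0.\<close>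

definition sqrt_coeff :: "nat \<Rightarrow> real" where
  "sqrt_coeff k = ((1/2) gchoose k) * (-1) ^ k"

text \<open>Vandermonde's identity for \<open>1/2 + 1/2\<close>: the square of the series is
  \<open>1 - x\<close>.\<close>

lemma sqrt_coeff_convolution:
  "(\<Sum>i\<le>n. sqrt_coeff i * sqrt_coeff (n - i)) = (if n = 0 then 1 else if n = 1 then -1 else 0)"
proof -
  have "(\<Sum>i\<le>n. sqrt_coeff i * sqrt_coeff (n - i)) = (\<Sum>i\<le>n. (((1/2) gchoose i) * ((1/2) gchoose (n - i))) * (-1) ^ n)"
  proof (intro sum.cong refl)
    fix i assume "i \<in> {..n}"
    hence "(-1::real) ^ n = (-1) ^ i * (-1) ^ (n - i)"
      by (simp flip: power_add)
    thus "sqrt_coeff i * sqrt_coeff (n - i) = (((1/2) gchoose i) * ((1/2) gchoose (n - i))) * (-1) ^ n"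
      by (simp add: sqrt_coeff_def)
  qed
  also have "\<dots> = ((1/2 + 1/2 :: real) gchoose n) * (-1) ^ n"
    unfolding gbinomial_Vandermonde[symmetric] by (simp add: sum_distrib_right atLeast0AtMost)
  also have "(1/2 + 1/2 :: real) gchoose n = real (1 choose n)"
    by (simp add: binomial_gbinomial)
  finally show ?thesis
    by (cases n) auto
qed

text \<open>All coefficients after the first are nonpositive, so the absolute partial sums are 2
  minus the plain ones. The latter telescope to \<open>(-1)\<^sup>n ((-1/2) gchoose n)\<close>,
  which is nonnegative. Convergence on the boundary is needed since the series is later evaluated at
  a contraction that may have norm 1.\<close>

lemma summable_sqrt_coeff: "summable (\<lambda>k. \<bar>sqrt_coeff k\<bar>)"
proof (rule summableI_nonneg_bounded)
  have rec: "b (Suc n) = b n * (real n - a) / real (Suc n)"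
    if "b = (\<lambda>n. (a gchoose n) * (-1) ^ n)" for b n and a :: real
  proof -
    have "a gchoose Suc n = (a gchoose n) * (a - real n) / real (Suc n)"
      using gbinomial_mult_1[of a n] by (simp add: field_simps)
    thus ?thesis
      by (simp only: that power_Suc) (simp add: algebra_simps diff_divide_distrib)
  qed
  have neg: "sqrt_coeff (Suc k) \<le> 0" for k
  proof (induction k)
    case 0
    show ?case by (simp add: sqrt_coeff_def)
  next
    case (Suc k)
    have "sqrt_coeff (Suc (Suc k)) = sqrt_coeff (Suc k) * (real (Suc k) - 1/2) / real (Suc (Suc k))"
      by (rule rec) (simp add: fun_eq_iff sqrt_coeff_def)
    also have "\<dots> \<le> 0"
      using Suc by (intro divide_nonpos_nonneg mult_nonpos_nonneg) auto
    finally show ?case .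
  qed
  have nonneg: "((-1/2) gchoose k) * (-1::real) ^ k \<ge> 0" for k
  proof (induction k)
    case (Suc k)
    thus ?case
      by (subst rec[OF refl]) (auto intro!: divide_nonneg_nonneg mult_nonneg_nonneg)
  qed simp
  fix n
  show "0 \<le> \<bar>sqrt_coeff n\<bar>" by simp
  have abs: "\<bar>sqrt_coeff k\<bar> = (if k = 0 then 2 else 0) - sqrt_coeff k" for k
    using neg[of "k - 1"] by (cases k) (auto simp: sqrt_coeff_def)
  have "(\<Sum>k<n. \<bar>sqrt_coeff k\<bar>) \<le> (\<Sum>k\<le>n. \<bar>sqrt_coeff k\<bar>)"
    by (rule sum_mono2) auto
  also have "\<dots> = 2 - (\<Sum>k\<le>n. sqrt_coeff k)"
    by (simp add: abs sum_subtractf)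
  also have "(\<Sum>k\<le>n. sqrt_coeff k) = (-1) ^ n * ((-1/2) gchoose n)"
    unfolding sqrt_coeff_def by (subst gbinomial_sum_lower_neg) simp
  finally show "(\<Sum>k<n. \<bar>sqrt_coeff k\<bar>) \<le> 2"
    using nonneg[of n] by (simp add: mult.commute)
qed

section \<open>Square roots of positive kernels\<close>

text \<open>The squared norm of \<open>v - W v / c\<close> is
  \<open>|v|\<^sup>2 - 2 <v, W v> / c + |W v|\<^sup>2 / c\<^sup>2\<close>, so it suffices that
  \<open>|W v|\<^sup>2 \<le> c <v, W v>\<close>. This gives the contraction without
  eigenvalues.\<close>

lemma psd_contraction:
  assumes S: "finite S" and herm: "kadj W = W" and psd: "op_psd S W"
  obtains c where "c > 0"
    "\<And>v. (\<Sum>x\<in>S. (cmod (v x - (\<Sum>y\<in>S. W x y * v y) / of_real c))\<^sup>2) \<le> (\<Sum>x\<in>S. (cmod (v x))\<^sup>2)"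
proof -
  \<comment> \<open>The sum of the entry moduli dominates the quadratic form of \<open>W\<close>;
    the added 1 keeps \<open>c\<close> positive when \<open>W\<close> is zero.\<close>
  define c where "c = (\<Sum>x\<in>S. \<Sum>y\<in>S. cmod (W x y)) + 1"
  have c: "c > 0" unfolding c_def by (intro add_nonneg_pos sum_nonneg) auto
  define ap where "ap = (\<lambda>v x. \<Sum>y\<in>S. W x y * v y)"
  define ip :: "('a \<Rightarrow> complex) \<Rightarrow> ('a \<Rightarrow> complex) \<Rightarrow> complex"
    where "ip = (\<lambda>u v. \<Sum>x\<in>S. cnj (u x) * v x)"
  have herm': "cnj (W x y) = W y x" for x y
    using fun_cong[OF fun_cong[OF herm], of y x] by (simp add: kadj_def)
  have sym: "ip v (ap w) = ip (ap v) w" for v w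
    unfolding ip_def ap_def
    by (simp add: sum_distrib_left sum_distrib_right herm', subst sum.swap) (simp add: ac_simps)
  have pos: "Re (ip v (ap v)) \<ge> 0" for v
    using psd unfolding op_psd_def ip_def ap_def by (simp add: sum_distrib_left mult.assoc)
  have ipn: "Re (ip v v) = (\<Sum>x\<in>S. (cmod (v x))\<^sup>2)" for v
    unfolding ip_def by (simp add: cmod_def power2_eq_square)
  have bound: "Re (ip u (ap u)) \<le> c * Re (ip u u)" for u
  proof -
    have "Re (ip u (ap u)) \<le> cmod (ip u (ap u))" by (rule complex_Re_le_cmod)
    also have "\<dots> \<le> (\<Sum>x\<in>S. \<Sum>y\<in>S. cmod (cnj (u x) * (W x y * u y)))"
      unfolding ip_def ap_def sum_distrib_left by (intro order_trans[OF norm_sum] sum_mono norm_sum)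
    also have "\<dots> \<le> (\<Sum>x\<in>S. \<Sum>y\<in>S. cmod (W x y) * Re (ip u u))"
    proof (intro sum_mono)
      fix x y assume "x \<in> S" "y \<in> S"
      hence "(cmod (u x))\<^sup>2 \<le> Re (ip u u)" "(cmod (u y))\<^sup>2 \<le> Re (ip u u)"
        unfolding ipn using S by (auto intro: member_le_sum)
      hence "cmod (u x) * cmod (u y) \<le> Re (ip u u)"
        using sum_squares_bound[of "cmod (u x)" "cmod (u y)"] by linarith
      hence "cmod (W x y) * (cmod (u x) * cmod (u y)) \<le> cmod (W x y) * Re (ip u u)"
        by (rule mult_left_mono) simp
      thus "cmod (cnj (u x) * (W x y * u y)) \<le> cmod (W x y) * Re (ip u u)"
        by (simp add: norm_mult ac_simps)
    qed
    also have "\<dots> = (c - 1) * Re (ip u u)"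
      by (simp add: c_def sum_distrib_right)
    also have "\<dots> \<le> c * Re (ip u u)"
      unfolding ipn by (intro mult_right_mono sum_nonneg) auto
    finally show ?thesis .
  qed
  have exp: "ip (\<lambda>x. a x - b x / of_real c) (\<lambda>x. d x - e x / of_real c)
     = ip a d - ip a e / of_real c - ip b d / of_real c + ip b e / of_real c / of_real c" for a b d e
    unfolding ip_def
    by (simp add: algebra_simps sum.distrib sum_subtractf sum_divide_distrib)
  \<comment> \<open>Positivity of \<open>W\<close> is tested at \<open>v - u / c\<close> with
    \<open>u = W v\<close>: this gives
    \<open>0 \<le> <v, u> - 2 |u|\<^sup>2 / c + <u, W u> / c\<^sup>2\<close>, and
    \<open>bound\<close> makes the last term at most \<open>|u|\<^sup>2 / c\<close>.\<close>
  have key: "Re (ip (ap v) (ap v)) \<le> c * Re (ip v (ap v))" for v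
  proof -
    define u where "u = ap v"
    have "ap (\<lambda>x. v x - w x / of_real c) = (\<lambda>x. ap v x - ap w x / of_real c)" for w
      unfolding ap_def
      by (simp only: right_diff_distrib sum_subtractf times_divide_eq_right sum_divide_distrib)
    from this[of u] have "ap (\<lambda>x. v x - u x / of_real c) = (\<lambda>x. u x - ap u x / of_real c)"
      by (simp only: u_def)
    hence "Re (ip v u - ip v (ap u) / of_real c - ip u u / of_real c + ip u (ap u) / of_real c / of_real c) \<ge> 0"
      using pos[of "\<lambda>x. v x - u x / of_real c"] by (simp add: exp)
    moreover have "ip v (ap u) = ip u u" by (simp add: sym u_def)
    ultimately have "Re (ip v u) - 2 * (Re (ip u u) / c) + Re (ip u (ap u)) / c / c \<ge> 0"
      by simp
    moreover have "Re (ip u (ap u)) / c / c \<le> Re (ip u u) / c"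
      using bound[of u] c by (simp add: field_simps)
    ultimately have "Re (ip u u) / c \<le> Re (ip v u)" by linarith
    thus ?thesis using c by (simp add: field_simps u_def)
  qed
  show ?thesis
  proof (rule that[OF c])
    fix v
    have "(\<Sum>x\<in>S. (cmod (v x - (\<Sum>y\<in>S. W x y * v y) / of_real c))\<^sup>2)
       = Re (ip (\<lambda>x. v x - ap v x / of_real c) (\<lambda>x. v x - ap v x / of_real c))"
      by (simp add: ipn ap_def)
    also have "\<dots> = Re (ip v v) - 2 * (Re (ip v (ap v)) / c) + Re (ip (ap v) (ap v)) / c / c"
      unfolding exp by (simp add: sym)
    also have "\<dots> \<le> Re (ip v v)"
    proof -
      have "Re (ip (ap v) (ap v)) / c / c \<le> Re (ip v (ap v)) / c"
        using key[of v] c by (simp add: field_simps)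
      moreover have "Re (ip v (ap v)) / c \<ge> 0" using pos[of v] c by simp
      ultimately show ?thesis by linarith
    qed
    finally show "(\<Sum>x\<in>S. (cmod (v x - (\<Sum>y\<in>S. W x y * v y) / of_real c))\<^sup>2) \<le> (\<Sum>x\<in>S. (cmod (v x))\<^sup>2)"
      by (simp add: ipn)
  qed
qed

primrec kpow :: "'a set \<Rightarrow> ('a \<Rightarrow> 'a \<Rightarrow> complex) \<Rightarrow> nat \<Rightarrow> 'a \<Rightarrow> 'a \<Rightarrow> complex" where
  "kpow S A 0 = kone S"
| "kpow S A (Suc k) = kmul S A (kpow S A k)"

lemma ksupp_kpow: "ksupp S A \<Longrightarrow> ksupp S (kpow S A k)"
  by (induction k) (auto intro: ksupp_kmul)

lemma kpow_add:
  "finite S \<Longrightarrow> ksupp S A \<Longrightarrow> kmul S (kpow S A i) (kpow S A j) = kpow S A (i + j)"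
  by (induction i) (auto simp: kmul_kone_left ksupp_kpow kmul_assoc)

lemma kpow_commute:
  assumes "finite S" "ksupp S X" "kmul S X A = kmul S A X"
  shows "kmul S X (kpow S A k) = kmul S (kpow S A k) X"
proof (induction k)
  case (Suc k)
  show ?case
    by (simp only: kpow.simps kmul_assoc[symmetric] assms(3)) (simp only: kmul_assoc Suc)
qed (simp add: assms kmul_kone_left kmul_kone_right)

lemma kadj_kpow:
  assumes "finite S" "ksupp S A" shows "kadj (kpow S A k) = kpow S (kadj A) k"
proof (induction k)
  case (Suc k)
  have "kmul S (kpow S (kadj A) k) (kadj A) = kmul S (kadj A) (kpow S (kadj A) k)"
    by (rule kpow_commute[symmetric]) (use assms in auto)
  thus ?case using Suc by (simp add: kadj_kmul)
qed simp

text \<open>With \<open>W = c (I - A)\<close>, the root is \<open>sqrt c\<close> times the series of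
  \<open>sqrt (1 - x)\<close> at \<open>A\<close>. Since \<open>A\<close> is a contraction, its
  powers have bounded entries and absolute summability of the coefficients suffices, also for
  singular \<open>W\<close>. Being a limit of polynomials in \<open>W\<close>, the root commutes
  with whatever commutes with \<open>W\<close>.\<close>

lemma psd_sqrt:
  assumes S: "finite S" and W: "ksupp S W" "kadj W = W" "op_psd S W"
  obtains R where "ksupp S R" "kadj R = R" "kmul S R R = W"
    "\<And>X. ksupp S X \<Longrightarrow> kmul S X W = kmul S W X \<Longrightarrow> kmul S X R = kmul S R X"
proof -
  obtain c where c: "c > 0" and contr:
    "\<And>v. (\<Sum>x\<in>S. (cmod (v x - (\<Sum>y\<in>S. W x y * v y) / of_real c))\<^sup>2) \<le> (\<Sum>x\<in>S. (cmod (v x))\<^sup>2)"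
    by (rule psd_contraction[OF S W(2,3)]) (rule that)
  define A where "A = (\<lambda>x y. kone S x y - W x y / of_real c)"
  have suppA: "ksupp S A"
    using W(1) ksupp_kone[of S] unfolding ksupp_def A_def by auto
  have adjA: "kadj A = A"
  proof -
    have "cnj (W y x) = W x y" for x y
      using fun_cong[OF fun_cong[OF W(2)], of x y] by (simp add: kadj_def)
    thus ?thesis by (auto simp: A_def kadj_def kone_def fun_eq_iff)
  qed
  have mulA: "kmul S A B x z = B x z - (\<Sum>y\<in>S. W x y * B y z) / of_real c" if "x \<in> S" for B x z
    unfolding kmul_def A_def kone_def using S that
    by (simp add: left_diff_distrib sum_subtractf sum_divide_distrib if_distrib[of "\<lambda>x. x * _"] cong: if_cong)
  \<comment> \<open>Column \<open>z\<close> starts as a basis vector or as zero, and each further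
    factor \<open>A\<close> applies the contraction to it.\<close>
  have col: "(\<Sum>x\<in>S. (cmod (kpow S A k x z))\<^sup>2) \<le> 1" for k z
  proof (induction k)
    case 0
    have "(\<Sum>x\<in>S. (cmod (kpow S A 0 x z))\<^sup>2) = (\<Sum>x\<in>S. if x = z then 1 else 0)"
      by (intro sum.cong) (auto simp: kone_def)
    thus ?case using S by simp
  next
    case (Suc k)
    have "(\<Sum>x\<in>S. (cmod (kpow S A (Suc k) x z))\<^sup>2)
      = (\<Sum>x\<in>S. (cmod (kpow S A k x z - (\<Sum>y\<in>S. W x y * kpow S A k y z) / of_real c))\<^sup>2)"
      by (intro sum.cong) (simp_all add: mulA)
    also have "\<dots> \<le> (\<Sum>x\<in>S. (cmod (kpow S A k x z))\<^sup>2)" by (rule contr)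
    finally show ?case using Suc by simp
  qed
  have bd: "cmod (kpow S A k x z) \<le> 1" for k x z
  proof (cases "x \<in> S")
    case True
    have "(cmod (kpow S A k x z))\<^sup>2 \<le> (\<Sum>x\<in>S. (cmod (kpow S A k x z))\<^sup>2)"
      by (rule member_le_sum) (use S True in auto)
    also note col
    finally show ?thesis by (simp add: power_le_one_iff)
  next
    case False
    thus ?thesis using ksupp_kpow[OF suppA, of k] by (simp add: ksupp_def)
  qed
  define t where "t = (\<lambda>x y k. of_real (sqrt c * sqrt_coeff k) * kpow S A k x y)"
  define R where "R = (\<lambda>x y. \<Sum>k. t x y k)"
  have smn: "summable (\<lambda>k. norm (t x y k))" for x y
  proof (rule summable_comparison_test)
    show "summable (\<lambda>k. sqrt c * \<bar>sqrt_coeff k\<bar>)"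
      using summable_sqrt_coeff by (rule summable_mult)
    have "norm (t x y k) \<le> sqrt c * \<bar>sqrt_coeff k\<bar> * 1" for k
      unfolding t_def norm_mult using c bd[of k x y] by (intro mult_mono) (auto simp: norm_mult)
    thus "\<exists>N. \<forall>n\<ge>N. norm (norm (t x y n)) \<le> sqrt c * \<bar>sqrt_coeff n\<bar>" by simp
  qed
  have sums: "(t x y) sums R x y" for x y
    unfolding R_def by (rule summable_sums) (rule summable_norm_cancel[OF smn])
  show ?thesis
  proof
    show suppR: "ksupp S R"
      using ksupp_kpow[OF suppA] by (simp add: ksupp_def R_def t_def)
    show "kadj R = R"
    proof (intro ext)
      fix x y
      have "(\<lambda>k. cnj (t y x k)) sums cnj (R y x)"
        using sums[of y x] by (simp add: sums_cnj)
      moreover have "cnj (t y x k) = t x y k" for k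
        using fun_cong[OF fun_cong[OF kadj_kpow[OF S suppA, of k]], of x y] adjA
        by (simp add: t_def kadj_def)
      ultimately have "t x y sums cnj (R y x)" by simp
      hence "cnj (R y x) = R x y" using sums by (rule sums_unique2)
      thus "kadj R x y = R x y" by (simp add: kadj_def)
    qed
    show "kmul S R R = W"
    proof (intro ext)
      fix x z
      have "(\<lambda>n. \<Sum>y\<in>S. \<Sum>i\<le>n. t x y i * t y z (n - i)) sums (\<Sum>y\<in>S. R x y * R y z)"
        unfolding R_def by (intro sums_sum Cauchy_product_sums smn)
      moreover have "(\<Sum>y\<in>S. \<Sum>i\<le>n. t x y i * t y z (n - i)) =
         of_real (c * (if n = 0 then 1 else if n = 1 then -1 else 0)) * kpow S A n x z" for n
      proof -
        have "(\<Sum>y\<in>S. \<Sum>i\<le>n. t x y i * t y z (n - i)) =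
          (\<Sum>i\<le>n. of_real (c * (sqrt_coeff i * sqrt_coeff (n - i))) * kmul S (kpow S A i) (kpow S A (n - i)) x z)"
          unfolding t_def kmul_def sum_distrib_left using c
          by (subst sum.swap, intro sum.cong refl) (simp add: ac_simps flip: of_real_mult)
        also have "\<dots> = (\<Sum>i\<le>n. of_real (c * (sqrt_coeff i * sqrt_coeff (n - i))) * kpow S A n x z)"
          by (intro sum.cong refl) (simp add: kpow_add[OF S suppA])
        also have "\<dots> = of_real (c * (\<Sum>i\<le>n. sqrt_coeff i * sqrt_coeff (n - i))) * kpow S A n x z"
          by (simp add: sum_distrib_left sum_distrib_right)
        finally show ?thesis by (simp only: sqrt_coeff_convolution)
      qed
      ultimately have "(\<lambda>n. of_real (c * (if n = 0 then 1 else if n = 1 then -1 else 0)) * kpow S A n x z)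
         sums kmul S R R x z" by (simp add: kmul_def)
      \<comment> \<open>The convolution kills every term beyond the first two, which leaves
        \<open>c (I - A) = W\<close>.\<close>
      moreover have "(\<lambda>n. of_real (c * (if n = 0 then 1 else if n = 1 then -1 else 0)) * kpow S A n x z)
         sums (\<Sum>n\<in>{0,1}. of_real (c * (if n = 0 then 1 else if n = 1 then -1 else 0)) * kpow S A n x z)"
        by (rule sums_finite) auto
      ultimately have "kmul S R R x z = of_real c * (kone S x z - A x z)"
        by (subst sums_unique2) (auto simp: kmul_kone_right[OF S suppA] algebra_simps)
      thus "kmul S R R x z = W x z" using c by (simp add: A_def)
    qed
    fix X assume X: "ksupp S X" "kmul S X W = kmul S W X"
    have XA: "kmul S X A = kmul S A X"
    proof -
      have "kmul S X A = (\<lambda>x y. kmul S X (kone S) x y - kmul S X W x y / of_real c)"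
        unfolding A_def kmul_def
        by (simp only: right_diff_distrib sum_subtractf times_divide_eq_right sum_divide_distrib)
      moreover have "kmul S A X = (\<lambda>x y. kmul S (kone S) X x y - kmul S W X x y / of_real c)"
        unfolding A_def kmul_def
        by (simp only: left_diff_distrib sum_subtractf times_divide_eq_left sum_divide_distrib)
      ultimately show ?thesis using X S by (simp add: kmul_kone_left kmul_kone_right)
    qed
    show "kmul S X R = kmul S R X"
    proof (intro ext)
      fix x z
      have "(\<lambda>k. \<Sum>y\<in>S. X x y * t y z k) sums kmul S X R x z"
        unfolding kmul_def by (intro sums_sum sums_mult sums)
      moreover have "(\<lambda>k. \<Sum>y\<in>S. t x y k * X y z) sums kmul S R X x z"
        unfolding kmul_def by (intro sums_sum sums_mult2 sums)
      moreover have "(\<Sum>y\<in>S. X x y * t y z k) = (\<Sum>y\<in>S. t x y k * X y z)" for k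
      proof -
        have "(\<Sum>y\<in>S. X x y * t y z k) = of_real (sqrt c * sqrt_coeff k) * kmul S X (kpow S A k) x z"
          by (simp add: t_def kmul_def sum_distrib_left ac_simps)
        also have "\<dots> = of_real (sqrt c * sqrt_coeff k) * kmul S (kpow S A k) X x z"
          by (simp add: kpow_commute[OF S X(1) XA])
        also have "\<dots> = (\<Sum>y\<in>S. t x y k * X y z)"
          by (simp add: t_def kmul_def sum_distrib_left ac_simps)
        finally show ?thesis .
      qed
      ultimately show "kmul S X R x z = kmul S R X x z"
        by (simp only:) (rule sums_unique2)
    qed
  qed
qed

text \<open>The minimiser of the Hilbert-Schmidt norm is unique, hence fixed by every norm-preserving
  self-map. This replaces averaging over the Haar measure.\<close>

lemma unique_norm_minimizer:
  fixes K :: "('i \<Rightarrow> complex) set"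
  defines "nrm \<equiv> \<lambda>S f. \<Sum>p\<in>S. (cmod (f p))\<^sup>2"
  assumes S: "finite S" and ne: "K \<noteq> {}"
    and supp: "\<And>f p. f \<in> K \<Longrightarrow> p \<notin> S \<Longrightarrow> f p = 0"
    and mid: "\<And>f g. f \<in> K \<Longrightarrow> g \<in> K \<Longrightarrow> (\<lambda>p. (f p + g p) / 2) \<in> K"
    and closed: "\<And>F f. (\<And>n. F n \<in> K) \<Longrightarrow> (\<And>p. (\<lambda>n. F n p) \<longlonglongrightarrow> f p) \<Longrightarrow> f \<in> K"
  obtains f where "f \<in> K" "\<And>g. g \<in> K \<Longrightarrow> nrm S g = nrm S f \<Longrightarrow> g = f"
proof -
  \<comment> \<open>The parallelogram law, written with the midpoint because membership in
    \<open>K\<close> is known for midpoints.\<close>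
  have par: "nrm S (\<lambda>p. f p - g p) + 4 * nrm S (\<lambda>p. (f p + g p) / 2) = 2 * nrm S f + 2 * nrm S g" for f g
    unfolding nrm_def sum_distrib_left sum.distrib[symmetric]
    by (intro sum.cong refl)
      (simp add: norm_divide power_divide cmod_power2, simp add: power2_eq_square algebra_simps)
  have nn: "nrm S f \<ge> 0" for f unfolding nrm_def by (simp add: sum_nonneg)
  define m where "m = Inf (nrm S ` K)"
  have bdd: "bdd_below (nrm S ` K)" by (rule bdd_belowI2[of _ 0]) (rule nn)
  have lower: "m \<le> nrm S f" if "f \<in> K" for f
    unfolding m_def by (rule cInf_lower) (use that bdd in auto)
  have "\<exists>f\<in>K. nrm S f < m + 1 / real (Suc n)" for n
  proof -
    have "m < m + 1 / real (Suc n)" by simp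
    thus ?thesis unfolding m_def using cInf_lessD[of "nrm S ` K"] ne by fastforce
  qed
  then obtain F where F: "\<And>n. F n \<in> K" "\<And>n. nrm S (F n) < m + 1 / real (Suc n)" by metis
  \<comment> \<open>The midpoint has squared norm at least \<open>m\<close>, so the parallelogram
    law bounds the distance by the two excesses over \<open>m\<close>: a minimising sequence is
    Cauchy.\<close>
  have diff: "nrm S (\<lambda>p. F i p - F j p) \<le> 2 / real (Suc i) + 2 / real (Suc j)" for i j
    using par[of "F i" "F j"] lower[OF mid[OF F(1)[of i] F(1)[of j]]] F(2)[of i] F(2)[of j] by simp
  have conv: "convergent (\<lambda>n. F n p)" for p
  proof (cases "p \<in> S")
    case True
    have "Cauchy (\<lambda>n. F n p)"
    proof (rule metric_CauchyI)
      fix e :: real assume e: "e > 0"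
      hence "4 / e\<^sup>2 > 0" by simp
      obtain M :: nat where M: "4 / e\<^sup>2 < real M" using reals_Archimedean2 by blast
      have "dist (F i p) (F j p) < e" if "i \<ge> M" "j \<ge> M" for i j
      proof -
        have "(cmod (F i p - F j p))\<^sup>2 \<le> nrm S (\<lambda>p. F i p - F j p)"
          unfolding nrm_def by (rule member_le_sum) (use S True in auto)
        also have "\<dots> \<le> 2 / real (Suc i) + 2 / real (Suc j)" by (rule diff)
        also have "\<dots> \<le> 2 / real (Suc M) + 2 / real (Suc M)"
          using that by (intro add_mono divide_left_mono) auto
        also have "\<dots> < e\<^sup>2"
        proof -
          have "4 < e\<^sup>2 * real M" using M e by (simp add: field_simps)
          also have "\<dots> \<le> e\<^sup>2 * real (Suc M)" by (intro mult_left_mono) auto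
          finally have "4 / real (Suc M) < e\<^sup>2" by (simp add: divide_less_eq mult.commute)
          thus ?thesis by simp
        qed
        finally show ?thesis using e by (simp add: dist_norm power_less_imp_less_base)
      qed
      thus "\<exists>M. \<forall>i\<ge>M. \<forall>j\<ge>M. dist (F i p) (F j p) < e" by blast
    qed
    thus ?thesis by (simp add: Cauchy_convergent_iff)
  next
    case False
    thus ?thesis using supp[OF F(1)] by (simp add: convergent_const)
  qed
  define f where "f = (\<lambda>p. lim (\<lambda>n. F n p))"
  have lim: "(\<lambda>n. F n p) \<longlonglongrightarrow> f p" for p
    unfolding f_def using conv by (simp add: convergent_LIMSEQ_iff)
  have fK: "f \<in> K" by (rule closed[OF F(1) lim])
  have fm: "nrm S f = m"
  proof (rule antisym)
    have "(\<lambda>n. nrm S (F n)) \<longlonglongrightarrow> nrm S f"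
      unfolding nrm_def by (intro tendsto_intros lim)
    moreover have "(\<lambda>n. m + 1 / real (Suc n)) \<longlonglongrightarrow> m + 0"
      by (intro tendsto_intros LIMSEQ_Suc[OF lim_1_over_n])
    ultimately have "nrm S f \<le> m + 0"
      by (rule LIMSEQ_le) (use F(2) less_imp_le in blast)
    thus "nrm S f \<le> m" by simp
  qed (rule lower[OF fK])
  show ?thesis
  proof (rule that[OF fK])
    fix g assume g: "g \<in> K" "nrm S g = nrm S f"
    have "nrm S (\<lambda>p. g p - f p) \<le> 0"
      using par[of g f] lower[OF mid[OF g(1) fK]] g(2) fm by simp
    hence "nrm S (\<lambda>p. g p - f p) = 0" using nn by (rule antisym)
    hence "g p = f p" if "p \<in> S" for p
      unfolding nrm_def using S that by (simp add: sum_nonneg_eq_0_iff)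
    thus "g = f" using supp g(1) fK by (metis ext)
  qed
qed

section \<open>Amplification, partial traces and tensor powers\<close>

text \<open>Vectors become columns indexed by \<open>unit\<close>, so the quadratic form is a
  product of kernels and congruence reduces to associativity.\<close>

lemma op_psd_iff:
  "op_psd S A \<longleftrightarrow> (\<forall>V :: 'a \<Rightarrow> unit \<Rightarrow> complex.
     Im (kmul S (kadj V) (kmul S A V) () ()) = 0 \<and> Re (kmul S (kadj V) (kmul S A V) () ()) \<ge> 0)"
  (is "_ = (\<forall>V. ?P V)")
proof -
  have "kmul S (kadj V) (kmul S A V) () () = (\<Sum>x\<in>S. \<Sum>y\<in>S. cnj (V x ()) * A x y * V y ())" for V
    by (simp add: kmul_def kadj_def sum_distrib_left mult.assoc)
  thus ?thesis
    unfolding op_psd_def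
  proof (intro iffI allI)
    fix v :: "'a \<Rightarrow> complex"
    assume "\<And>V :: 'a \<Rightarrow> unit \<Rightarrow> complex. kmul S (kadj V) (kmul S A V) () ()
        = (\<Sum>x\<in>S. \<Sum>y\<in>S. cnj (V x ()) * A x y * V y ())" "\<forall>V. ?P V"
    from this(1)[of "\<lambda>x _. v x"] spec[OF this(2), of "\<lambda>x _. v x"]
    show "Im (\<Sum>x\<in>S. \<Sum>y\<in>S. cnj (v x) * A x y * v y) = 0 \<and>
      Re (\<Sum>x\<in>S. \<Sum>y\<in>S. cnj (v x) * A x y * v y) \<ge> 0" by simp
  qed simp
qed

lemma op_psd_congruence:
  assumes "op_psd S A" shows "op_psd S' (kmul S (kadj C) (kmul S A C))"
  unfolding op_psd_iff
proof
  fix V :: "'b \<Rightarrow> unit \<Rightarrow> complex"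
  have "kmul S' (kadj V) (kmul S' (kmul S (kadj C) (kmul S A C)) V)
     = kmul S (kadj (kmul S' C V)) (kmul S A (kmul S' C V))"
    by (simp only: kadj_kmul kmul_assoc)
  thus "Im (kmul S' (kadj V) (kmul S' (kmul S (kadj C) (kmul S A C)) V) () ()) = 0 \<and>
     Re (kmul S' (kadj V) (kmul S' (kmul S (kadj C) (kmul S A C)) V) () ()) \<ge> 0"
    using assms unfolding op_psd_iff by simp
qed

lemma op_psd_cong:
  assumes "\<And>x y. x \<in> S \<Longrightarrow> y \<in> S \<Longrightarrow> A x y = B x y"
  shows "op_psd S A \<longleftrightarrow> op_psd S B"
proof -
  have "(\<Sum>x\<in>S. \<Sum>y\<in>S. cnj (v x) * A x y * v y) = (\<Sum>x\<in>S. \<Sum>y\<in>S. cnj (v x) * B x y * v y)" for v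
    using assms by (intro sum.cong refl) auto
  thus ?thesis unfolding op_psd_def by simp
qed

lemma op_between_0_I_cong:
  assumes "\<And>x y. x \<in> S \<Longrightarrow> y \<in> S \<Longrightarrow> A x y = B x y"
  shows "op_between_0_I S A \<longleftrightarrow> op_between_0_I S B"
proof -
  have "op_psd S A \<longleftrightarrow> op_psd S B"
    by (rule op_psd_cong) (rule assms)
  moreover have "op_psd S (\<lambda>x y. (if x = y then 1 else 0) - A x y)
      \<longleftrightarrow> op_psd S (\<lambda>x y. (if x = y then 1 else 0) - B x y)"
    by (rule op_psd_cong) (simp add: assms)
  ultimately show ?thesis by (simp only: op_between_0_I_def)
qed

lemma op_between_0_I_kone:
  "op_between_0_I S T \<longleftrightarrow> op_psd S T \<and> op_psd S (\<lambda>x y. kone S x y - T x y)"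
proof -
  have "op_psd S (\<lambda>x y. (if x = y then 1 else 0) - T x y) \<longleftrightarrow> op_psd S (\<lambda>x y. kone S x y - T x y)"
    by (rule op_psd_cong) (simp add: kone_def)
  thus ?thesis by (simp only: op_between_0_I_def)
qed

lemma op_psd_reindex:
  assumes h: "bij_betw h S' S" and psd: "op_psd S T"
  shows "op_psd S' (\<lambda>x y. T (h x) (h y))"
  unfolding op_psd_def
proof
  fix v :: "'a \<Rightarrow> complex"
  define w where "w = (\<lambda>x. v (inv_into S' h x))"
  have w: "w (h x) = v x" if "x \<in> S'" for x
    using h that by (simp add: w_def bij_betw_inv_into_left)
  have "(\<Sum>x\<in>S'. \<Sum>y\<in>S'. cnj (v x) * T (h x) (h y) * v y)
    = (\<Sum>x\<in>S'. \<Sum>y\<in>S'. cnj (w (h x)) * T (h x) (h y) * w (h y))"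
    by (intro sum.cong refl) (simp add: w)
  also have "\<dots> = (\<Sum>x\<in>S'. \<Sum>y\<in>S. cnj (w (h x)) * T (h x) y * w y)"
    by (intro sum.cong refl sum.reindex_bij_betw[OF h])
  also have "\<dots> = (\<Sum>x\<in>S. \<Sum>y\<in>S. cnj (w x) * T x y * w y)"
    by (rule sum.reindex_bij_betw[OF h])
  finally have eq: "(\<Sum>x\<in>S'. \<Sum>y\<in>S'. cnj (v x) * T (h x) (h y) * v y) = \<dots>" .
  show "Im (\<Sum>x\<in>S'. \<Sum>y\<in>S'. cnj (v x) * T (h x) (h y) * v y) = 0 \<and>
     Re (\<Sum>x\<in>S'. \<Sum>y\<in>S'. cnj (v x) * T (h x) (h y) * v y) \<ge> 0"
    unfolding eq using psd unfolding op_psd_def by blast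
qed

lemma op_between_0_I_reindex:
  assumes h: "bij_betw h S' S" and T: "op_between_0_I S T"
  shows "op_between_0_I S' (\<lambda>x y. T (h x) (h y))"
proof -
  have "op_psd S' (\<lambda>x y. (if h x = h y then 1 else 0) - T (h x) (h y))"
    using op_psd_reindex[OF h, of "\<lambda>x y. (if x = y then 1 else 0) - T x y"] T
    unfolding op_between_0_I_def by blast
  moreover have "op_psd S' (\<lambda>x y. (if h x = h y then 1 else 0) - T (h x) (h y)) \<longleftrightarrow>
     op_psd S' (\<lambda>x y. (if x = y then 1 else 0) - T (h x) (h y))"
    using h by (intro op_psd_cong) (auto simp: bij_betw_def inj_on_eq_iff)
  ultimately show ?thesis
    using op_psd_reindex[OF h, of T] T unfolding op_between_0_I_def by blast
qed

section \<open>Amplification and partial trace\<close>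

text \<open>The operator \<open>\<sigma> \<otimes> I\<close>, with the identity cut down to
  \<open>B\<close> so that support conditions pass from \<open>\<sigma>\<close> to it.\<close>

definition amp :: "'b set \<Rightarrow> ('a \<Rightarrow> 'a \<Rightarrow> complex) \<Rightarrow> 'a \<times> 'b \<Rightarrow> 'a \<times> 'b \<Rightarrow> complex" where
  "amp B \<sigma> = (\<lambda>(a, b) (a', b'). if b = b' \<and> b \<in> B then \<sigma> a a' else 0)"

definition ptrace :: "'b set \<Rightarrow> ('a \<times> 'b \<Rightarrow> 'a \<times> 'b \<Rightarrow> complex) \<Rightarrow> 'a \<Rightarrow> 'a \<Rightarrow> complex" where
  "ptrace B W = (\<lambda>a a'. \<Sum>b\<in>B. W (a, b) (a', b))"

lemma kmul_amp_left:
  assumes "finite B"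
  shows "kmul (A \<times> B) (amp B \<sigma>) W (a, b) q = (if b \<in> B then \<Sum>a'\<in>A. \<sigma> a a' * W (a', b) q else 0)"
proof -
  have "kmul (A \<times> B) (amp B \<sigma>) W (a, b) q
     = (\<Sum>a'\<in>A. \<Sum>b'\<in>B. if b = b' then (if b \<in> B then \<sigma> a a' * W (a', b) q else 0) else 0)"
    unfolding kmul_def sum.cartesian_product
    by (intro sum.cong refl) (auto simp: amp_def)
  thus ?thesis using assms by simp
qed

lemma kadj_amp: "kadj (amp B \<sigma>) = amp B (kadj \<sigma>)"
  by (auto simp: kadj_def amp_def fun_eq_iff)

lemma kmul_amp_right:
  assumes "finite B"
  shows "kmul (A \<times> B) W (amp B \<sigma>) p (a, b) = (if b \<in> B then \<Sum>a'\<in>A. W p (a', b) * \<sigma> a' a else 0)"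
proof -
  have "kmul (A \<times> B) W (amp B \<sigma>) p (a, b) = cnj (kmul (A \<times> B) (amp B (kadj \<sigma>)) (kadj W) (a, b) p)"
    unfolding kadj_amp[symmetric] kadj_kmul[symmetric] by (simp add: kadj_def)
  thus ?thesis using assms by (simp add: kmul_amp_left kadj_def mult.commute)
qed

lemma ksupp_amp: "ksupp A \<sigma> \<Longrightarrow> ksupp (A \<times> B) (amp B \<sigma>)"
  by (auto simp: ksupp_def amp_def)

lemma amp_kmul: "finite B \<Longrightarrow> amp B (kmul A \<sigma> \<tau>) = kmul (A \<times> B) (amp B \<sigma>) (amp B \<tau>)"
proof (intro ext)
  fix p q :: "'b \<times> 'a"
  assume "finite B"
  obtain a b a' b' where [simp]: "p = (a, b)" "q = (a', b')" by (metis surj_pair)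
  show "amp B (kmul A \<sigma> \<tau>) p q = kmul (A \<times> B) (amp B \<sigma>) (amp B \<tau>) p q"
    using \<open>finite B\<close> by (cases "b = b'") (simp_all add: kmul_amp_left, simp_all add: amp_def kmul_def)
qed

lemma amp_kone: "amp B (kone A) = kone (A \<times> B)"
  by (auto simp: amp_def kone_def fun_eq_iff)

text \<open>Duality of partial trace and amplification: an operator trivial on the second factor
  sees only the marginal of \<open>W\<close>.\<close>

lemma ktrace_amp:
  assumes "finite B"
  shows "ktrace (A \<times> B) (kmul (A \<times> B) W (amp B \<sigma>)) = ktrace A (kmul A (ptrace B W) \<sigma>)"
proof -
  have "ktrace (A \<times> B) (kmul (A \<times> B) W (amp B \<sigma>)) = (\<Sum>a\<in>A. \<Sum>b\<in>B. \<Sum>a'\<in>A. W (a, b) (a', b) * \<sigma> a' a)"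
    unfolding ktrace_def sum.cartesian_product' using assms
    by (intro sum.cong refl) (simp add: kmul_amp_right)
  also have "\<dots> = (\<Sum>a\<in>A. \<Sum>a'\<in>A. \<Sum>b\<in>B. W (a, b) (a', b) * \<sigma> a' a)"
    by (intro sum.cong refl sum.swap)
  finally show ?thesis by (simp add: ktrace_def kmul_def ptrace_def sum_distrib_right)
qed

text \<open>Operators on the first factor pass through a trace over the second. Hence conjugation by
  an amplified unitary keeps a partial trace equal to the identity.\<close>

lemma ptrace_amp:
  assumes "finite B"
  shows "ptrace B (kmul (A \<times> B) (amp B \<sigma>) (kmul (A \<times> B) W (amp B \<tau>))) = kmul A \<sigma> (kmul A (ptrace B W) \<tau>)"
proof (intro ext)
  fix a a'
  have "ptrace B (kmul (A \<times> B) (amp B \<sigma>) (kmul (A \<times> B) W (amp B \<tau>))) a a'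
     = (\<Sum>b\<in>B. \<Sum>c\<in>A. \<sigma> a c * (\<Sum>c'\<in>A. W (c, b) (c', b) * \<tau> c' a'))"
    using assms by (simp add: ptrace_def kmul_amp_left kmul_amp_right)
  also have "\<dots> = (\<Sum>c\<in>A. \<sigma> a c * (\<Sum>c'\<in>A. (\<Sum>b\<in>B. W (c, b) (c', b)) * \<tau> c' a'))"
  proof (subst sum.swap, intro sum.cong refl, subst sum_distrib_left[symmetric])
    fix c
    have "(\<Sum>b\<in>B. \<Sum>c'\<in>A. W (c, b) (c', b) * \<tau> c' a') = (\<Sum>c'\<in>A. (\<Sum>b\<in>B. W (c, b) (c', b)) * \<tau> c' a')"
      by (subst sum.swap) (simp add: sum_distrib_right)
    thus "\<sigma> a c * (\<Sum>b\<in>B. \<Sum>c'\<in>A. W (c, b) (c', b) * \<tau> c' a')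
        = \<sigma> a c * (\<Sum>c'\<in>A. (\<Sum>b\<in>B. W (c, b) (c', b)) * \<tau> c' a')" by simp
  qed
  finally show "ptrace B (kmul (A \<times> B) (amp B \<sigma>) (kmul (A \<times> B) W (amp B \<tau>))) a a' = kmul A \<sigma> (kmul A (ptrace B W) \<tau>) a a'"
    by (simp add: kmul_def ptrace_def)
qed

lemma op_psd_sum:
  assumes "\<And>b. b \<in> B \<Longrightarrow> op_psd S (W b)"
  shows "op_psd S (\<lambda>x y. \<Sum>b\<in>B. W b x y)"
  unfolding op_psd_def
proof
  fix v :: "'b \<Rightarrow> complex"
  define g where "g = (\<lambda>b. \<Sum>x\<in>S. \<Sum>y\<in>S. cnj (v x) * W b x y * v y)"
  have "(\<Sum>x\<in>S. \<Sum>y\<in>S. cnj (v x) * (\<Sum>b\<in>B. W b x y) * v y)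
    = (\<Sum>x\<in>S. \<Sum>b\<in>B. \<Sum>y\<in>S. cnj (v x) * W b x y * v y)"
    by (intro sum.cong refl, subst sum.swap) (simp add: sum_distrib_left sum_distrib_right)
  also have "\<dots> = (\<Sum>b\<in>B. \<Sum>x\<in>S. \<Sum>y\<in>S. cnj (v x) * W b x y * v y)"
    by (rule sum.swap)
  also have "\<dots> = (\<Sum>b\<in>B. g b)" by (simp only: g_def)
  finally have eq: "(\<Sum>x\<in>S. \<Sum>y\<in>S. cnj (v x) * (\<Sum>b\<in>B. W b x y) * v y) = (\<Sum>b\<in>B. g b)" .
  have g: "Im (g b) = 0" "Re (g b) \<ge> 0" if "b \<in> B" for b
    using assms[OF that] unfolding op_psd_def g_def by blast+
  show "Im (\<Sum>x\<in>S. \<Sum>y\<in>S. cnj (v x) * (\<Sum>b\<in>B. W b x y) * v y) = 0 \<and>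
     Re (\<Sum>x\<in>S. \<Sum>y\<in>S. cnj (v x) * (\<Sum>b\<in>B. W b x y) * v y) \<ge> 0"
    unfolding eq Im_sum Re_sum using g by (auto intro!: sum.neutral sum_nonneg)
qed

text \<open>The partial trace is a sum over \<open>b\<close> of congruences by the embeddings of
  \<open>a\<close> as \<open>(a, b)\<close>.\<close>

lemma op_psd_ptrace:
  assumes fin: "finite A" "finite B" and psd: "op_psd (A \<times> B) W"
  shows "op_psd A (ptrace B W)"
  unfolding ptrace_def
proof (rule op_psd_sum)
  fix b assume b: "b \<in> B"
  define J :: "'a \<times> 'b \<Rightarrow> 'a \<Rightarrow> complex" where "J = (\<lambda>p a. if p = (a, b) then 1 else 0)"
  have "op_psd A (kmul (A \<times> B) (kadj J) (kmul (A \<times> B) W J))"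
    by (rule op_psd_congruence[OF psd])
  moreover have "kmul (A \<times> B) (kadj J) (kmul (A \<times> B) W J) x y = W (x, b) (y, b)"
    if "x \<in> A" "y \<in> A" for x y
    unfolding kmul_def kadj_def J_def using that b fin
    by (simp add: if_distrib[of cnj] if_distrib[of "\<lambda>x. x * _"] if_distrib[of "\<lambda>x. _ * x"] cong: if_cong)
  ultimately show "op_psd A (\<lambda>x y. W (x, b) (y, b))"
    using op_psd_cong[of A _ "\<lambda>x y. W (x, b) (y, b)"] by blast
qed

text \<open>The dual decomposition: \<open>\<sigma> \<otimes> I\<close> is a sum over
  \<open>b\<close> of congruences by the projections onto the slice with second component
  \<open>b\<close>.\<close>

lemma op_psd_amp:
  assumes fin: "finite A" "finite B" and psd: "op_psd A \<sigma>"
  shows "op_psd (A \<times> B) (amp B \<sigma>)"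
proof -
  define J :: "'b \<Rightarrow> 'a \<Rightarrow> 'a \<times> 'b \<Rightarrow> complex" where "J = (\<lambda>b a p. if p = (a, b) then 1 else 0)"
  have "op_psd (A \<times> B) (\<lambda>p q. \<Sum>b\<in>B. kmul A (kadj (J b)) (kmul A \<sigma> (J b)) p q)"
    by (intro op_psd_sum op_psd_congruence psd)
  moreover have "(\<Sum>b\<in>B. kmul A (kadj (J b)) (kmul A \<sigma> (J b)) p q) = amp B \<sigma> p q"
    if "p \<in> A \<times> B" "q \<in> A \<times> B" for p q
  proof -
    obtain a b a' b' where pq: "p = (a, b)" "q = (a', b')" "a \<in> A" "b \<in> B" "a' \<in> A" "b' \<in> B"
      using \<open>p \<in> A \<times> B\<close> \<open>q \<in> A \<times> B\<close> by auto
    have "kmul A (kadj (J c)) (kmul A \<sigma> (J c)) p q = (if c = b then (if b = b' then \<sigma> a a' else 0) else 0)" for c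
    proof -
      have "kmul A \<sigma> (J c) x q = (if c = b' then \<sigma> x a' else 0)" for x
        using fin pq by (cases "c = b'")
          (simp_all add: kmul_def J_def if_distrib[of "\<lambda>x. _ * x"] cong: if_cong)
      hence "kmul A (kadj (J c)) (kmul A \<sigma> (J c)) p q
          = (\<Sum>x\<in>A. cnj (J c x p) * (if c = b' then \<sigma> x a' else 0))"
        by (subst kmul_def) (simp only: kadj_def)
      also have "\<dots> = (\<Sum>x\<in>A. if x = a then (if c = b then (if b = b' then \<sigma> a a' else 0) else 0) else 0)"
        by (intro sum.cong refl) (auto simp: J_def pq)
      finally show ?thesis using fin pq by simp
    qed
    thus ?thesis using fin pq by (simp add: amp_def)
  qed
  hence "op_psd (A \<times> B) (\<lambda>p q. \<Sum>b\<in>B. kmul A (kadj (J b)) (kmul A \<sigma> (J b)) p q)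
      \<longleftrightarrow> op_psd (A \<times> B) (amp B \<sigma>)" by (rule op_psd_cong)
  ultimately show ?thesis by simp
qed

lemma op_between_0_I_amp:
  assumes fin: "finite A" "finite B" and T: "op_between_0_I A \<sigma>"
  shows "op_between_0_I (A \<times> B) (amp B \<sigma>)"
proof -
  have "(\<lambda>p q. kone (A \<times> B) p q - amp B \<sigma> p q) = amp B (\<lambda>x y. kone A x y - \<sigma> x y)"
    unfolding amp_kone[symmetric] by (auto simp: amp_def fun_eq_iff)
  thus ?thesis
    using T op_psd_amp[OF fin] unfolding op_between_0_I_kone by simp
qed

section \<open>Tensor powers indexed by lists\<close>

lemma finite_lists_len [simp]: "finite (lists_len N :: 'd::finite list set)"
  using finite_lists_length_eq[of "UNIV :: 'd set" N] by (simp add: lists_len_def)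

lemma sum_lists_len_Suc:
  "(\<Sum>a\<in>lists_len (Suc N). f a) = (\<Sum>x\<in>UNIV. \<Sum>a\<in>lists_len N. f (x # a))"
proof -
  have "bij_betw (\<lambda>(x, a). x # a) (UNIV \<times> lists_len N) (lists_len (Suc N))"
    by (rule bij_betwI[of _ _ _ "\<lambda>a. (hd a, tl a)"]) (auto simp: lists_len_def length_Suc_conv)
  from sum.reindex_bij_betw[OF this, of f] show ?thesis
    by (simp add: sum.cartesian_product split_def)
qed

lemma tensor_pow_Cons: "tensor_pow (Suc N) X (x # a) (y # b) = X x y * tensor_pow N X a b"
  by (simp add: tensor_pow_def prod.lessThan_Suc_shift del: prod.lessThan_Suc)

lemma tensor_pow_kmul:
  fixes Y :: "'d::finite \<Rightarrow> 'c \<Rightarrow> complex"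
  assumes "length a = N" "length c = N"
  shows "tensor_pow N (kmul UNIV X X') a c = (\<Sum>b\<in>lists_len N. tensor_pow N X a b * tensor_pow N X' b c)"
  using assms
proof (induction N arbitrary: a c)
  case 0
  thus ?case by (simp add: tensor_pow_def lists_len_def)
next
  case (Suc N)
  then obtain x a' z c' where [simp]: "a = x # a'" "c = z # c'" "length a' = N" "length c' = N"
    by (metis length_Suc_conv)
  have "tensor_pow (Suc N) (kmul UNIV X X') a c
     = (\<Sum>y\<in>UNIV. X x y * X' y z) * (\<Sum>b\<in>lists_len N. tensor_pow N X a' b * tensor_pow N X' b c')"
    by (simp add: tensor_pow_Cons Suc.IH) (simp add: kmul_def)
  thus ?case
    by (simp add: sum_lists_len_Suc tensor_pow_Cons sum_product ac_simps)
qed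

text \<open>\<open>tensor_pow\<close> also takes values at lists of other lengths; setting these to
  0 makes multiplicativity and the rule for the identity equations of functions.\<close>

definition tens :: "nat \<Rightarrow> ('d \<Rightarrow> 'd \<Rightarrow> complex) \<Rightarrow> 'd list \<Rightarrow> 'd list \<Rightarrow> complex" where
  "tens N X = (\<lambda>a b. if a \<in> lists_len N \<and> b \<in> lists_len N then tensor_pow N X a b else 0)"

lemma ksupp_tens: "ksupp (lists_len N) (tens N X)"
  by (auto simp: ksupp_def tens_def)

lemma tens_kmul: "tens N (kmul UNIV X Y) = kmul (lists_len N) (tens N X) (tens N Y)"
proof (intro ext)
  fix a c
  show "tens N (kmul UNIV X Y) a c = kmul (lists_len N) (tens N X) (tens N Y) a c"
  proof (cases "a \<in> lists_len N \<and> c \<in> lists_len N")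
    case True
    hence "kmul (lists_len N) (tens N X) (tens N Y) a c
        = (\<Sum>b\<in>lists_len N. tensor_pow N X a b * tensor_pow N Y b c)"
      unfolding kmul_def by (intro sum.cong) (auto simp: tens_def)
    thus ?thesis using True by (simp add: tens_def tensor_pow_kmul lists_len_def)
  next
    case False
    thus ?thesis by (auto simp: tens_def kmul_def[of "lists_len N"] intro!: sum.neutral)
  qed
qed

lemma tens_kadj: "tens N (kadj X) = kadj (tens N X)"
  by (auto simp: fun_eq_iff tens_def kadj_def tensor_pow_def)

lemma tens_kone: "tens N (kone UNIV) = kone (lists_len N)"
proof (intro ext)
  fix a b :: "'a list"
  show "tens N (kone UNIV) a b = kone (lists_len N) a b"
  proof (cases "a = b")
    case False
    have "\<exists>k<N. a ! k \<noteq> b ! k" if "length a = N" "length b = N"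
      using that False by (metis nth_equalityI)
    thus ?thesis using False by (auto simp: tens_def kone_def tensor_pow_def lists_len_def)
  qed (auto simp: tens_def kone_def tensor_pow_def)
qed

section \<open>Bipartite pure states and twirling\<close>

text \<open>The rank-one operator of the vector with coefficient matrix \<open>X\<close>, without
  normalisation. Operators on the first factor then act on \<open>X\<close> from the left, those on
  the second from the right.\<close>

definition pstate :: "('a \<Rightarrow> 'b \<Rightarrow> complex) \<Rightarrow> 'a \<times> 'b \<Rightarrow> 'a \<times> 'b \<Rightarrow> complex" where
  "pstate X = (\<lambda>(a, b) (a', b'). X a b * cnj (X a' b'))"

lemma pure_state_pstate:
  assumes "pure_state \<rho>" obtains X where "\<rho> = pstate X"
proof -
  obtain \<psi> where "\<And>i j. \<rho> i j = \<psi> i * cnj (\<psi> j)"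
    using assms unfolding pure_state_def by blast
  hence "\<rho> = pstate (curry \<psi>)" by (auto simp: pstate_def fun_eq_iff)
  thus thesis by (rule that)
qed

text \<open>An operator on the second factor multiplies the coefficient matrix on the right by its
  transpose; conjugating with the transpose of \<open>V\<close> leaves \<open>V\<close>
  itself.\<close>

lemma conj_B_pstate: "conj_B (\<lambda>b c. V c b) (pstate X) = pstate (kmul UNIV X V)"
  unfolding conj_B_def pstate_def kmul_def
  by (auto simp: fun_eq_iff sum_product intro!: sum.cong)

text \<open>On basis indices, this is the regrouping of N bipartite systems into N first and N
  second factors.\<close>

lemma bij_betw_zip:
  "bij_betw (\<lambda>(a, b). zip a b) (lists_len N \<times> lists_len N) (lists_len N)"
  by (rule bij_betwI[of _ _ _ "\<lambda>xs. (map fst xs, map snd xs)"])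
    (auto simp: lists_len_def zip_map_fst_snd)

lemma bij_betw_unzip:
  "bij_betw (\<lambda>xs. (map fst xs, map snd xs)) (lists_len N) (lists_len N \<times> lists_len N)"
  by (rule bij_betwI[of _ _ _ "\<lambda>(a, b). zip a b"])
    (auto simp: lists_len_def zip_map_fst_snd)

lemma tensor_pow_pstate:
  assumes "a \<in> lists_len N" "b \<in> lists_len N" "a' \<in> lists_len N" "b' \<in> lists_len N"
  shows "tensor_pow N (pstate X) (zip a b) (zip a' b') = pstate (tens N X) (a, b) (a', b')"
  using assms by (simp add: tensor_pow_def pstate_def tens_def lists_len_def prod.distrib)

text \<open>Agreement is required on lists of length \<open>N\<close> only, so that the lemma serves
  both the given tester and the pair \<open>local_A M\<close>, \<open>amp L M\<close>, which may
  differ elsewhere.\<close>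

lemma trace_prod_pstate:
  assumes T': "\<And>a b a' b'. a \<in> lists_len N \<Longrightarrow> b \<in> lists_len N \<Longrightarrow> a' \<in> lists_len N \<Longrightarrow> b' \<in> lists_len N \<Longrightarrow>
     T' (a, b) (a', b') = T (zip a b) (zip a' b')"
  defines "S \<equiv> lists_len N \<times> lists_len N"
  shows "trace_prod (lists_len N) T (tensor_pow N (pstate X)) = ktrace S (kmul S T' (pstate (tens N X)))"
proof -
  let ?h = "\<lambda>(a, b). zip a b"
  have "trace_prod (lists_len N) T (tensor_pow N (pstate X))
     = (\<Sum>p\<in>S. \<Sum>y\<in>lists_len N. T (?h p) y * tensor_pow N (pstate X) y (?h p))"
    unfolding trace_prod_def S_def by (rule sum.reindex_bij_betw[OF bij_betw_zip, symmetric])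
  also have "\<dots> = (\<Sum>p\<in>S. \<Sum>q\<in>S. T (?h p) (?h q) * tensor_pow N (pstate X) (?h q) (?h p))"
    unfolding S_def by (intro sum.cong refl sum.reindex_bij_betw[OF bij_betw_zip, symmetric])
  also have "\<dots> = (\<Sum>p\<in>S. \<Sum>q\<in>S. T' p q * pstate (tens N X) q p)"
    unfolding S_def by (intro sum.cong refl) (auto simp: T' tensor_pow_pstate)
  finally show ?thesis by (simp add: ktrace_def kmul_def)
qed

text \<open>The coefficient matrix of \<open>\<Omega>\<close> is the identity; without normalisation
  the partial trace is exactly \<open>I\<close>.\<close>

definition maxent :: "'a set \<Rightarrow> 'a \<times> 'a \<Rightarrow> 'a \<times> 'a \<Rightarrow> complex" where
  "maxent A = pstate (kone A)"

lemma pstate_maxent: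
  assumes "finite A" "ksupp A X"
  shows "pstate X = kmul (A \<times> A) (amp A X) (kmul (A \<times> A) (maxent A) (kadj (amp A X)))"
proof (intro ext)
  fix p q :: "'a \<times> 'a"
  obtain a b a' b' where [simp]: "p = (a, b)" "q = (a', b')" by (metis surj_pair)
  have X: "(\<Sum>c\<in>A. X a c * kone A c b) = X a b" for a b
    using fun_cong[OF fun_cong[OF kmul_kone_right[OF assms]], of a b] by (simp add: kmul_def)
  have supp: "X a b = 0" if "b \<notin> A" for a b
    using assms(2) that by (simp add: ksupp_def)
  have "(if b' \<in> A then \<Sum>c\<in>A. cnj (kone A c b') * cnj (X a' c) else 0) = cnj (X a' b')"
    using arg_cong[OF X[of a' b'], of cnj] by (simp add: mult.commute supp)
  hence inner: "kmul (A \<times> A) (maxent A) (kadj (amp A X)) (c, b) q = kone A c b * cnj (X a' b')" for c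
    using assms(1) by (cases "b' \<in> A")
      (simp_all add: kadj_amp kmul_amp_right maxent_def pstate_def, simp_all add: kadj_def mult.assoc flip: sum_distrib_left)
  have "(\<Sum>c\<in>A. X a c * (kone A c b * z)) = X a b * z" for z
    by (simp add: mult.assoc[symmetric] sum_distrib_right[symmetric] X)
  thus "pstate X p q = kmul (A \<times> A) (amp A X) (kmul (A \<times> A) (maxent A) (kadj (amp A X))) p q"
    using assms(1) inner by (simp add: kmul_amp_left pstate_def supp)
qed

lemma ksupp_maxent: "ksupp (A \<times> A) (maxent A)"
  by (auto simp: ksupp_def maxent_def pstate_def kone_def)

lemma kadj_pstate: "kadj (pstate X) = pstate X"
  by (auto simp: pstate_def kadj_def fun_eq_iff)

lemma op_psd_pstate: "op_psd S (pstate X)"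
proof -
  have "op_psd {()} (\<lambda>_ _. 1)"
    unfolding op_psd_def by (simp add: cmod_power2[symmetric])
  \<comment> \<open>A rank-one kernel is a congruence of the scalar 1 by a row vector.\<close>
  from op_psd_congruence[OF this, of S "\<lambda>_ (a, b). cnj (X a b)"]
  show ?thesis by (simp add: kmul_def kadj_def pstate_def split_def)
qed

lemma ptrace_pstate: "ptrace B (pstate X) = kmul B X (kadj X)"
  by (simp add: ptrace_def pstate_def kmul_def kadj_def)

text \<open>The kernels \<open>W\<close> that can stand in for the average of \<open>(I \<otimes> U) \<Omega>\<Omega>\<^sup>* (I \<otimes> U)\<^sup>*\<close> over
  unitaries \<open>U\<close>, where \<open>\<Omega>\<close> is the unnormalised maximally entangled vector: a pure state with
  coefficient matrix \<open>X\<close> is \<open>(X \<otimes> I) \<Omega>\<close>.\<close>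

definition twirl_candidate ::
  "real \<Rightarrow> real \<Rightarrow> nat \<Rightarrow> ('d::finite \<times> 'd \<Rightarrow> 'd \<times> 'd \<Rightarrow> complex) set \<Rightarrow> ('d \<times> 'd \<Rightarrow> 'd \<times> 'd \<Rightarrow> complex) set
    \<Rightarrow> ('d list \<times> 'd list \<Rightarrow> 'd list \<times> 'd list \<Rightarrow> complex) \<Rightarrow> ('d list \<times> 'd list \<Rightarrow> 'd list \<times> 'd list \<Rightarrow> complex) \<Rightarrow> bool"
  where
  "twirl_candidate c s N Pyes Pno T W \<longleftrightarrow>
     (let L = lists_len N; S = L \<times> L;
          p = (\<lambda>X. Re (ktrace S (kmul S T (kmul S (amp L (tens N X)) (kmul S W (kadj (amp L (tens N X))))))))
      in ksupp S W \<and> kadj W = W \<and> op_psd S W \<and> ptrace L W = kone L \<and>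
         (\<forall>X. pstate X \<in> Pyes \<longrightarrow> c \<le> p X) \<and> (\<forall>X. pstate X \<in> Pno \<longrightarrow> p X \<le> s))"

section \<open>Closure properties of the candidates and the commuting one\<close>

text \<open>Conjugating \<open>W\<close> changes the acceptance value at \<open>X\<close> into the
  one at \<open>X V\<close>, and invariance keeps the state of \<open>X V\<close> on the same side
  of the property.\<close>

lemma twirl_candidate_conj:
  fixes Pyes Pno :: "('d::finite \<times> 'd \<Rightarrow> 'd \<times> 'd \<Rightarrow> complex) set"
  assumes inv: "unitarily_invariant_B Pyes Pno" and V: "kunitary V"
    and W: "twirl_candidate c s N Pyes Pno T W"
  defines "L \<equiv> lists_len N :: 'd list set" and "S \<equiv> (lists_len N \<times> lists_len N) :: ('d list \<times> 'd list) set"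
    and "U \<equiv> amp (lists_len N) (tens N V)"
  shows "twirl_candidate c s N Pyes Pno T (kmul S U (kmul S W (kadj U)))"
proof -
  have fin: "finite L" by (simp add: L_def)
  have S: "S = L \<times> L" by (simp add: S_def L_def)
  have U: "U = amp L (tens N V)" by (simp add: U_def L_def)
  have suppU: "ksupp S U" unfolding U S L_def by (intro ksupp_amp ksupp_tens)
  have uni: "unitary_op (\<lambda>b c. V c b)"
    unfolding unitary_op_def
  proof (intro allI)
    fix i j
    have "(\<Sum>k\<in>UNIV. cnj (V i k) * V j k) = kmul UNIV V (kadj V) j i"
      by (simp add: kmul_def kadj_def mult.commute)
    thus "(\<Sum>k\<in>UNIV. cnj (V i k) * V j k) = (if i = j then 1 else 0)"
      using V by (auto simp: kunitary_def kone_def)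
  qed
  have yes_conj: "pstate (kmul UNIV X V) \<in> Pyes" if "pstate X \<in> Pyes" for X
    using inv uni that unfolding unitarily_invariant_B_def conj_B_pstate[symmetric] by blast
  have no_conj: "pstate (kmul UNIV X V) \<in> Pno" if "pstate X \<in> Pno" for X
    using inv uni that unfolding unitarily_invariant_B_def conj_B_pstate[symmetric] by blast
  \<comment> \<open>Multiplicativity of \<open>tens\<close> and \<open>amp\<close> merges the two
    conjugations into a single one by \<open>X V\<close>.\<close>
  have absorb: "kmul S (amp L (tens N X)) (kmul S (kmul S U (kmul S W (kadj U))) (kadj (amp L (tens N X))))
     = kmul S (amp L (tens N (kmul UNIV X V))) (kmul S W (kadj (amp L (tens N (kmul UNIV X V)))))" for X
    unfolding tens_kmul L_def[symmetric] amp_kmul[OF fin] S[symmetric] U kadj_kmul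
    by (simp only: kmul_assoc)
  have "ptrace L (kmul S U (kmul S W (kadj U))) = kone L"
  proof -
    have "ptrace L (kmul S U (kmul S W (kadj U)))
       = kmul L (tens N V) (kmul L (ptrace L W) (kadj (tens N V)))"
      unfolding U S kadj_amp by (rule ptrace_amp[OF fin])
    also have "\<dots> = tens N (kmul UNIV V (kadj V))"
      using W fin by (simp add: twirl_candidate_def Let_def L_def kmul_kone_left ksupp_tens tens_kmul tens_kadj)
    also have "\<dots> = kone L"
      using V by (simp add: kunitary_def tens_kone L_def)
    finally show ?thesis .
  qed
  moreover have "op_psd S (kmul S U (kmul S W (kadj U)))"
    using op_psd_congruence[of S W S "kadj U"] W by (simp add: twirl_candidate_def Let_def S_def)
  moreover have "kadj (kmul S U (kmul S W (kadj U))) = kmul S U (kmul S W (kadj U))"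
    using W by (simp add: twirl_candidate_def Let_def kadj_kmul kmul_assoc)
  moreover have "ksupp S (kmul S U (kmul S W (kadj U)))"
    using W suppU by (intro ksupp_kmul) (simp_all add: twirl_candidate_def Let_def S_def)
  ultimately show ?thesis
    using W yes_conj no_conj unfolding twirl_candidate_def Let_def L_def[symmetric] S[symmetric] absorb by blast
qed

lemma norm_sum_conj:
  assumes S: "finite S" and W: "ksupp S W" and U: "kmul S (kadj U) U = kone S"
  shows "(\<Sum>(p, q)\<in>S \<times> S. (cmod (kmul S U (kmul S W (kadj U)) p q))\<^sup>2) = (\<Sum>(p, q)\<in>S \<times> S. (cmod (W p q))\<^sup>2)"
proof -
  have HS: "complex_of_real (\<Sum>(p, q)\<in>S \<times> S. (cmod (A p q))\<^sup>2) = ktrace S (kmul S A (kadj A))" for A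
    by (simp only: of_real_sum sum.cartesian_product[symmetric] complex_norm_square ktrace_def kmul_def kadj_def)
  have "ktrace S (kmul S (kmul S U (kmul S W (kadj U))) (kadj (kmul S U (kmul S W (kadj U)))))
     = ktrace S (kmul S U (kmul S W (kmul S (kmul S (kadj U) U) (kmul S (kadj W) (kadj U)))))"
    by (simp add: kadj_kmul kmul_assoc)
  also have "\<dots> = ktrace S (kmul S U (kmul S W (kmul S (kadj W) (kadj U))))"
    using S W by (simp only: U kmul_assoc[of S S W "kone S", symmetric] kmul_kone_right)
  also have "\<dots> = ktrace S (kmul S (kmul S W (kmul S (kadj W) (kadj U))) U)"
    by (rule ktrace_cyclic)
  also have "\<dots> = ktrace S (kmul S W (kadj W))"
    using S W by (simp add: kmul_assoc U kmul_kone_right)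
  finally show ?thesis
    unfolding HS[symmetric] of_real_eq_iff .
qed

text \<open>Supplies nonemptiness: for the maximally entangled kernel the acceptance values are
  those of the original tester.\<close>

lemma twirl_candidate_maxent:
  assumes "\<And>X. pstate X \<in> Pyes \<Longrightarrow> c \<le> Re (ktrace (lists_len N \<times> lists_len N) (kmul (lists_len N \<times> lists_len N) T (pstate (tens N X))))"
    and "\<And>X. pstate X \<in> Pno \<Longrightarrow> Re (ktrace (lists_len N \<times> lists_len N) (kmul (lists_len N \<times> lists_len N) T (pstate (tens N X)))) \<le> s"
  shows "twirl_candidate c s N Pyes Pno T (maxent (lists_len N))"
  unfolding twirl_candidate_def Let_def pstate_maxent[OF finite_lists_len ksupp_tens, symmetric]
  using assms
  by (simp add: ksupp_maxent)
    (simp add: maxent_def kadj_pstate op_psd_pstate ptrace_pstate kmul_kone_left)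

lemma kmul_midpoint_left:
  "kmul S (\<lambda>p q. (B p q + C p q) / 2) A = (\<lambda>p q. (kmul S B A p q + kmul S C A p q) / 2)"
  by (simp add: kmul_def distrib_right sum.distrib add_divide_distrib sum_divide_distrib)

lemma kmul_midpoint_right:
  "kmul S A (\<lambda>p q. (B p q + C p q) / 2) = (\<lambda>p q. (kmul S A B p q + kmul S A C p q) / 2)"
  by (simp add: kmul_def distrib_left sum.distrib add_divide_distrib sum_divide_distrib)

lemma op_psd_midpoint:
  assumes "op_psd S B" "op_psd S C"
  shows "op_psd S (\<lambda>p q. (B p q + C p q) / 2)"
  using assms unfolding op_psd_iff kmul_midpoint_left kmul_midpoint_right by simp

text \<open>Support, symmetry, partial trace and acceptance values are affine in \<open>W\<close>
  over the reals, and positivity is a convex condition.\<close>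

lemma twirl_candidate_midpoint:
  fixes Pyes Pno :: "('d::finite \<times> 'd \<Rightarrow> 'd \<times> 'd \<Rightarrow> complex) set"
  assumes W: "twirl_candidate c s N Pyes Pno T W" and W': "twirl_candidate c s N Pyes Pno T W'"
  shows "twirl_candidate c s N Pyes Pno T (\<lambda>p q. (W p q + W' p q) / 2)"
proof -
  define L where "L = (lists_len N :: 'd list set)"
  define S where "S = L \<times> L"
  define Z where "Z = (\<lambda>p q. (W p q + W' p q) / 2)"
  define p where "p = (\<lambda>W X. Re (ktrace S (kmul S T (kmul S (amp L (tens N X)) (kmul S W (kadj (amp L (tens N X))))))))"
  have cand: "twirl_candidate c s N Pyes Pno T W \<longleftrightarrow>
      ksupp S W \<and> kadj W = W \<and> op_psd S W \<and> ptrace L W = kone L \<and>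
      (\<forall>X. pstate X \<in> Pyes \<longrightarrow> c \<le> p W X) \<and> (\<forall>X. pstate X \<in> Pno \<longrightarrow> p W X \<le> s)" for W
    by (simp add: twirl_candidate_def Let_def L_def S_def p_def)
  note W = W[unfolded cand] and W' = W'[unfolded cand]
  have p: "p Z X = (p W X + p W' X) / 2" for X
    unfolding p_def Z_def kmul_midpoint_left kmul_midpoint_right
    by (simp add: ktrace_def sum.distrib flip: sum_divide_distrib)
  have "kadj Z = (\<lambda>p q. (kadj W p q + kadj W' p q) / 2)"
    by (simp add: kadj_def Z_def)
  hence "kadj Z = Z" using W W' by (simp add: Z_def)
  moreover have "ptrace L Z = (\<lambda>a a'. (ptrace L W a a' + ptrace L W' a a') / 2)"
    by (simp add: ptrace_def Z_def sum.distrib flip: sum_divide_distrib)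
  hence "ptrace L Z = kone L" using W W' by simp
  moreover have "op_psd S Z" unfolding Z_def using W W' by (blast intro: op_psd_midpoint)
  moreover have "ksupp S Z" using W W' by (simp add: ksupp_def Z_def)
  moreover have "c \<le> p Z X" if "pstate X \<in> Pyes" for X
  proof -
    have "c \<le> p W X" "c \<le> p W' X" using W W' that by blast+
    thus ?thesis by (simp add: p)
  qed
  moreover have "p Z X \<le> s" if "pstate X \<in> Pno" for X
  proof -
    have "p W X \<le> s" "p W' X \<le> s" using W W' that by blast+
    thus ?thesis by (simp add: p)
  qed
  ultimately show ?thesis unfolding Z_def[symmetric] cand by blast
qed

lemma tendsto_kmul:
  assumes "\<And>p q. (\<lambda>n. A n p q) \<longlonglongrightarrow> A' p q" "\<And>p q. (\<lambda>n. B n p q) \<longlonglongrightarrow> B' p q"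
  shows "(\<lambda>n. kmul S (A n) (B n) p q) \<longlonglongrightarrow> kmul S A' B' p q"
  unfolding kmul_def by (intro tendsto_intros assms)

text \<open>Every condition is an equation or a non-strict inequality between finite sums that
  depend continuously on the entries of \<open>W\<close>.\<close>

lemma twirl_candidate_limit:
  fixes Pyes Pno :: "('d::finite \<times> 'd \<Rightarrow> 'd \<times> 'd \<Rightarrow> complex) set"
  assumes F: "\<And>n. twirl_candidate c s N Pyes Pno T (F n)" and lim: "\<And>p q. (\<lambda>n. F n p q) \<longlonglongrightarrow> W p q"
  shows "twirl_candidate c s N Pyes Pno T W"
proof -
  define L where "L = (lists_len N :: 'd list set)"
  define S where "S = L \<times> L"
  define p where "p = (\<lambda>W X. Re (ktrace S (kmul S T (kmul S (amp L (tens N X)) (kmul S W (kadj (amp L (tens N X))))))))"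
  have F': "ksupp S (F n)" "kadj (F n) = F n" "op_psd S (F n)" "ptrace L (F n) = kone L"
    "\<And>X. pstate X \<in> Pyes \<Longrightarrow> c \<le> p (F n) X" "\<And>X. pstate X \<in> Pno \<Longrightarrow> p (F n) X \<le> s" for n
    using F[of n] by (simp_all add: twirl_candidate_def Let_def L_def S_def p_def)
  have p: "(\<lambda>n. p (F n) X) \<longlonglongrightarrow> p W X" for X
    unfolding p_def ktrace_def by (intro tendsto_intros tendsto_kmul lim)
  have "W x y = 0" if "x \<notin> S \<or> y \<notin> S" for x y
  proof (rule LIMSEQ_unique[OF lim])
    have "F n x y = 0" for n using F'(1)[of n] that unfolding ksupp_def by blast
    thus "(\<lambda>n. F n x y) \<longlonglongrightarrow> 0" by simp
  qed
  hence "ksupp S W" by (simp add: ksupp_def)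
  moreover have "kadj W = W"
  proof (intro ext LIMSEQ_unique)
    fix x y
    show "(\<lambda>n. F n x y) \<longlonglongrightarrow> W x y" by (rule lim)
    have "(\<lambda>n. kadj (F n) x y) \<longlonglongrightarrow> kadj W x y"
      unfolding kadj_def by (intro tendsto_intros lim)
    thus "(\<lambda>n. F n x y) \<longlonglongrightarrow> kadj W x y" by (simp add: F')
  qed
  moreover have "op_psd S W"
    unfolding op_psd_iff
  proof
    fix V :: "'d list \<times> 'd list \<Rightarrow> unit \<Rightarrow> complex"
    let ?q = "\<lambda>W. kmul S (kadj V) (kmul S W V) () ()"
    have q: "(\<lambda>n. ?q (F n)) \<longlonglongrightarrow> ?q W"
      by (intro tendsto_kmul tendsto_const lim)
    have "(\<lambda>n. Im (?q (F n))) \<longlonglongrightarrow> Im (?q W)" by (intro tendsto_intros q)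
    hence "Im (?q W) = 0"
      using F'(3) LIMSEQ_unique[OF _ tendsto_const] unfolding op_psd_iff by auto
    moreover have "Re (?q W) \<ge> 0"
      by (rule LIMSEQ_le_const[OF tendsto_Re[OF q]]) (use F'(3) in \<open>auto simp: op_psd_iff\<close>)
    ultimately show "Im (?q W) = 0 \<and> Re (?q W) \<ge> 0" by simp
  qed
  moreover have "ptrace L W = kone L"
  proof (intro ext LIMSEQ_unique)
    fix x y
    show "(\<lambda>n. ptrace L (F n) x y) \<longlonglongrightarrow> ptrace L W x y"
      unfolding ptrace_def by (intro tendsto_intros lim)
    show "(\<lambda>n. ptrace L (F n) x y) \<longlonglongrightarrow> kone L x y" by (simp add: F')
  qed
  moreover have "c \<le> p W X" if "pstate X \<in> Pyes" for X
    by (rule LIMSEQ_le_const[OF p]) (use F'(5) that in blast)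
  moreover have "p W X \<le> s" if "pstate X \<in> Pno" for X
    by (rule LIMSEQ_le_const2[OF p]) (use F'(6) that in blast)
  ultimately show ?thesis
    by (simp add: twirl_candidate_def Let_def L_def S_def p_def)
qed

text \<open>Conjugation by an amplified unitary tensor power preserves both the candidates and the
  norm, so it fixes the unique candidate of least norm; being fixed means commuting. Density extends
  this to all matrices.\<close>

lemma twirl_candidate_commuting:
  fixes Pyes Pno :: "('d::finite \<times> 'd \<Rightarrow> 'd \<times> 'd \<Rightarrow> complex) set"
  assumes inv: "unitarily_invariant_B Pyes Pno" and W0: "twirl_candidate c s N Pyes Pno T W0"
  defines "L \<equiv> lists_len N :: 'd list set"
  obtains W where "twirl_candidate c s N Pyes Pno T W"
    "\<And>X. kmul (L \<times> L) (amp L (tens N X)) W = kmul (L \<times> L) W (amp L (tens N X))"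
proof -
  define S where "S = L \<times> L"
  have fin: "finite L" "finite S" by (simp_all add: L_def S_def)
  \<comment> \<open>Currying matches kernels with the functions of one index that the minimisation
    is about.\<close>
  define K where "K = {f. twirl_candidate c s N Pyes Pno T (curry f)}"
  obtain f where f: "f \<in> K" and uniq: "\<And>g. g \<in> K \<Longrightarrow>
      (\<Sum>p\<in>S \<times> S. (cmod (g p))\<^sup>2) = (\<Sum>p\<in>S \<times> S. (cmod (f p))\<^sup>2) \<Longrightarrow> g = f"
  proof (rule unique_norm_minimizer[of "S \<times> S" K])
    show "finite (S \<times> S)" using fin by simp
    have "curry (\<lambda>(p, q). W0 p q) = W0" by (simp add: fun_eq_iff)
    thus "K \<noteq> {}" using W0 unfolding K_def by (metis empty_iff mem_Collect_eq)
    show "g p = 0" if "g \<in> K" "p \<notin> S \<times> S" for g p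
      using that unfolding K_def
      by (cases p) (auto simp: twirl_candidate_def Let_def ksupp_def S_def L_def)
    show "(\<lambda>p. (g p + h p) / 2) \<in> K" if "g \<in> K" "h \<in> K" for g h
      using that twirl_candidate_midpoint[of c s N Pyes Pno T "curry g" "curry h"]
      by (simp add: K_def curry_def)
    show "g \<in> K" if "\<And>n. F n \<in> K" "\<And>p. (\<lambda>n. F n p) \<longlonglongrightarrow> g p" for F g
      unfolding K_def mem_Collect_eq
      by (rule twirl_candidate_limit[of c s N Pyes Pno T "\<lambda>n. curry (F n)"]) 
        (use that in \<open>auto simp: K_def\<close>)
  qed blast
  define W where "W = curry f"
  have W: "twirl_candidate c s N Pyes Pno T W" using f by (simp add: K_def W_def)
  have suppW: "ksupp S W" using W by (simp add: twirl_candidate_def Let_def S_def L_def)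
  have "kmul S (amp L (tens N X)) W = kmul S W (amp L (tens N X))" for X
  proof (induction X rule: unitary_dense_induct)
    case (mult A B)
    thus ?case
      unfolding tens_kmul L_def[symmetric] amp_kmul[OF fin(1)] S_def[symmetric]
      by (metis kmul_assoc)
  next
    case (unitary V)
    define U where "U = amp L (tens N V)"
    have suppU: "ksupp S U" unfolding U_def S_def L_def by (intro ksupp_amp ksupp_tens)
    have UU: "kmul S (kadj U) U = kone S"
    proof -
      have "kmul S (kadj U) U = amp L (tens N (kmul UNIV (kadj V) V))"
        by (simp add: U_def S_def kadj_amp amp_kmul fin tens_kmul tens_kadj flip: L_def)
      also have "\<dots> = kone S"
        using unitary by (simp add: kunitary_def tens_kone amp_kone S_def flip: L_def)
      finally show ?thesis .
    qed
    define W' where "W' = kmul S U (kmul S W (kadj U))"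
    have "(\<lambda>(p, q). W' p q) \<in> K"
      using twirl_candidate_conj[OF inv unitary W] by (simp add: K_def W'_def U_def S_def L_def)
    moreover have "(\<Sum>p\<in>S \<times> S. (cmod (case p of (p, q) \<Rightarrow> W' p q))\<^sup>2) = (\<Sum>p\<in>S \<times> S. (cmod (f p))\<^sup>2)"
      using norm_sum_conj[OF fin(2) suppW UU] by (simp add: W'_def W_def split_def)
    ultimately have "(\<lambda>(p, q). W' p q) = f" by (rule uniq)
    hence "W' = W" by (auto simp: W_def fun_eq_iff)
    hence "kmul S W U = kmul S W' U" by simp
    also have "\<dots> = kmul S U W"
      by (simp add: W'_def kmul_assoc UU kmul_kone_right[OF fin(2) suppW])
    finally show ?case by (simp add: U_def)
  next
    case (line A B w)
    have entry: "\<exists>P. \<forall>w. poly P w = tens N (\<lambda>i j. A i j + w * B i j) a b" for a b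
    proof (cases "a \<in> lists_len N \<and> b \<in> lists_len N")
      case True
      hence "poly (\<Prod>k<N. [:A (a ! k) (b ! k), B (a ! k) (b ! k):]) w = tens N (\<lambda>i j. A i j + w * B i j) a b" for w
        by (simp add: poly_prod tens_def tensor_pow_def)
      thus ?thesis by blast
    next
      case False
      hence "poly 0 w = tens N (\<lambda>i j. A i j + w * B i j) a b" for w by (auto simp: tens_def)
      thus ?thesis by blast
    qed
    then obtain P where P: "\<And>a b w. poly (P a b) w = tens N (\<lambda>i j. A i j + w * B i j) a b" by metis
    show ?case
    proof (intro ext)
      fix p q :: "'d list \<times> 'd list"
      obtain a b a' b' where pq: "p = (a, b)" "q = (a', b')" by (metis surj_pair)
      \<comment> \<open>One entry of the commutator, as a polynomial in the line parameter:
        infinitely many roots force it to be zero.\<close>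
      define Q where "Q = (if b \<in> L then \<Sum>c\<in>L. P a c * [:W (c, b) q:] else 0)
         - (if b' \<in> L then \<Sum>c\<in>L. [:W p (c, b'):] * P c a' else 0)"
      have Q: "poly Q w = kmul S (amp L (tens N (\<lambda>i j. A i j + w * B i j))) W p q
         - kmul S W (amp L (tens N (\<lambda>i j. A i j + w * B i j))) p q" for w
        using fin by (simp add: Q_def pq S_def kmul_amp_left kmul_amp_right poly_sum P mult.commute)
      hence "infinite {w. poly Q w = 0}"
        by (intro infinite_super[OF _ line]) auto
      hence "Q = 0" using poly_roots_finite by blast
      thus "kmul S (amp L (tens N (\<lambda>i j. A i j + w * B i j))) W p q
         = kmul S W (amp L (tens N (\<lambda>i j. A i j + w * B i j))) p q"
        using Q[of w] by simp
    qed
  qed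
  thus thesis using that[OF W] by (simp add: S_def)
qed

section \<open>Construction of the local tester\<close>

lemma local_tester_exists:
  fixes Pyes Pno :: "('d::finite \<times> 'd \<Rightarrow> 'd \<times> 'd \<Rightarrow> complex) set"
  assumes pure: "pure_property Pyes Pno" and inv: "unitarily_invariant_B Pyes Pno"
    and T: "is_tester c s N Pyes Pno T"
  obtains M :: "'d list \<Rightarrow> 'd list \<Rightarrow> complex" where
    "op_between_0_I (lists_len N) M" "is_tester c s N Pyes Pno (local_A M)"
proof -
  define L where "L = (lists_len N :: 'd list set)"
  define S where "S = L \<times> L"
  have fin: "finite L" "finite S" by (simp_all add: L_def S_def)
  define T' where "T' = (\<lambda>p q. T (case p of (a, b) \<Rightarrow> zip a b) (case q of (a, b) \<Rightarrow> zip a b))"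
  have T': "op_between_0_I S T'"
    using op_between_0_I_reindex[OF bij_betw_zip] T unfolding T'_def S_def L_def is_tester_def by blast
  have trT: "trace_prod (lists_len N) T (tensor_pow N (pstate X)) = ktrace S (kmul S T' (pstate (tens N X)))" for X
    unfolding S_def L_def by (rule trace_prod_pstate) (simp add: T'_def)
  have W0: "twirl_candidate c s N Pyes Pno T' (maxent (lists_len N))"
    using T trT by (intro twirl_candidate_maxent) (auto simp: is_tester_def S_def L_def)
  obtain W where W: "twirl_candidate c s N Pyes Pno T' W" and
    comm: "\<And>X. kmul S (amp L (tens N X)) W = kmul S W (amp L (tens N X))"
    using twirl_candidate_commuting[OF inv W0] unfolding S_def L_def by blast
  have suppX: "ksupp S (amp L (tens N X))" for X
    unfolding S_def L_def by (intro ksupp_amp ksupp_tens)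
  have W': "ksupp S W" "kadj W = W" "op_psd S W" and ptrW: "ptrace L W = kone L"
    using W by (simp_all add: twirl_candidate_def Let_def S_def L_def)
  obtain R where R: "ksupp S R" "kadj R = R" "kmul S R R = W"
    and "\<And>X. ksupp S X \<Longrightarrow> kmul S X W = kmul S W X \<Longrightarrow> kmul S X R = kmul S R X"
    by (rule psd_sqrt[OF fin(2) W']) (rule that)
  hence commR: "kmul S (amp L (tens N X)) R = kmul S R (amp L (tens N X))" for X
    using suppX comm by blast
  define M where "M = ptrace L (kmul S R (kmul S T' R))"
  have psdM: "op_psd L M"
    unfolding M_def using op_psd_congruence[of S T' S R] T' R(2)
    by (intro op_psd_ptrace[OF fin(1) fin(1)]) (simp add: S_def op_between_0_I_def)
  \<comment> \<open>Since \<open>R R = W\<close> has partial trace \<open>I\<close>, the difference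
    \<open>I - M\<close> is the partial trace of \<open>R (I - T') R\<close>.\<close>
  have "op_psd L (\<lambda>x y. kone L x y - M x y)"
  proof -
    have "op_psd S (kmul S R (kmul S (\<lambda>x y. kone S x y - T' x y) R))"
      using op_psd_congruence[of S "\<lambda>x y. kone S x y - T' x y" S R] T' R(2) by (simp add: op_between_0_I_kone)
    moreover have "kmul S R (kmul S (\<lambda>x y. kone S x y - T' x y) R) = (\<lambda>x y. W x y - kmul S R (kmul S T' R) x y)"
    proof -
      have "kmul S (\<lambda>x y. kone S x y - T' x y) R = (\<lambda>x y. R x y - kmul S T' R x y)"
        using kmul_kone_left[OF fin(2) R(1)]
        by (simp add: kmul_def left_diff_distrib sum_subtractf fun_eq_iff)
      thus ?thesis
        unfolding R(3)[symmetric] by (simp add: kmul_def right_diff_distrib sum_subtractf)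
    qed
    ultimately have "op_psd S (\<lambda>x y. W x y - kmul S R (kmul S T' R) x y)" by simp
    hence "op_psd L (ptrace L (\<lambda>x y. W x y - kmul S R (kmul S T' R) x y))"
      unfolding S_def by (rule op_psd_ptrace[OF fin(1) fin(1)])
    moreover have "ptrace L (\<lambda>x y. W x y - kmul S R (kmul S T' R) x y) = (\<lambda>x y. kone L x y - M x y)"
      unfolding ptrW[symmetric] M_def by (simp add: ptrace_def sum_subtractf)
    ultimately show ?thesis by simp
  qed
  with psdM have M: "op_between_0_I L M" by (simp add: op_between_0_I_kone)
  \<comment> \<open>The state enters a local test only through its marginal
    \<open>Y Y\<^sup>*\<close>, with \<open>Y = tens N X\<close>. Duality turns this back into a
    trace over both factors, where one \<open>R\<close> is moved cyclically so that \<open>Y\<close>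
    and its adjoint can be passed by the two roots.\<close>
  have trM: "ktrace S (kmul S (amp L M) (pstate (tens N X)))
    = ktrace S (kmul S T' (kmul S (amp L (tens N X)) (kmul S W (kadj (amp L (tens N X))))))" for X
  proof -
    let ?X = "amp L (tens N X)"
    have "ktrace S (kmul S (amp L M) (pstate (tens N X))) = ktrace S (kmul S (pstate (tens N X)) (amp L M))"
      by (rule ktrace_cyclic)
    also have "\<dots> = ktrace L (kmul L (kmul L (tens N X) (kadj (tens N X))) M)"
      unfolding S_def ktrace_amp[OF fin(1)] ptrace_pstate ..
    also have "\<dots> = ktrace L (kmul L M (kmul L (tens N X) (kadj (tens N X))))"
      by (rule ktrace_cyclic)
    also have "\<dots> = ktrace S (kmul S (kmul S R (kmul S T' R)) (amp L (kmul L (tens N X) (kadj (tens N X)))))"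
      unfolding S_def M_def by (rule ktrace_amp[OF fin(1), symmetric])
    also have "\<dots> = ktrace S (kmul S R (kmul S (kmul S T' R) (kmul S ?X (kadj ?X))))"
      unfolding amp_kmul[OF fin(1)] kadj_amp S_def kmul_assoc ..
    also have "\<dots> = ktrace S (kmul S (kmul S (kmul S T' R) (kmul S ?X (kadj ?X))) R)"
      by (rule ktrace_cyclic)
    also have "\<dots> = ktrace S (kmul S T' (kmul S (kmul S R ?X) (kmul S (kadj ?X) R)))"
      by (simp only: kmul_assoc)
    \<comment> \<open>The adjoint of an amplified tensor power is again one, so commutation for all
      matrices covers it.\<close>
    also have "kmul S (kadj ?X) R = kmul S R (kadj ?X)"
      using commR[of "kadj X"] by (simp only: tens_kadj kadj_amp)
    also have "kmul S (kmul S R ?X) (kmul S R (kadj ?X)) = kmul S ?X (kmul S (kmul S R R) (kadj ?X))"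
      unfolding commR[symmetric] by (simp only: kmul_assoc)
    finally show ?thesis by (simp only: R(3))
  qed
  have trA: "trace_prod (lists_len N) (local_A M) (tensor_pow N (pstate X))
      = ktrace S (kmul S T' (kmul S (amp L (tens N X)) (kmul S W (kadj (amp L (tens N X))))))" for X
  proof -
    have "trace_prod (lists_len N) (local_A M) (tensor_pow N (pstate X))
        = ktrace S (kmul S (amp L M) (pstate (tens N X)))"
      unfolding S_def L_def
      by (rule trace_prod_pstate) (simp add: amp_def local_A_def lists_len_def)
    thus ?thesis by (simp only: trM)
  qed
  have "op_between_0_I (lists_len N) (local_A M :: ('d \<times> 'd) list \<Rightarrow> _)"
  proof -
    have "op_between_0_I (lists_len N) (\<lambda>xs ys. amp L M (map fst xs, map snd xs) (map fst ys, map snd ys))"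
      using op_between_0_I_reindex[OF bij_betw_unzip[of N], of "amp L M"] op_between_0_I_amp[OF fin(1) fin(1) M]
      by (simp add: L_def)
    moreover have "op_between_0_I (lists_len N) (\<lambda>xs ys. amp L M (map fst xs, map snd xs) (map fst ys, map snd ys))
       \<longleftrightarrow> op_between_0_I (lists_len N) (local_A M :: ('d \<times> 'd) list \<Rightarrow> _)"
      by (rule op_between_0_I_cong) (simp add: amp_def local_A_def L_def lists_len_def)
    ultimately show ?thesis by simp
  qed
  moreover have "c \<le> Re (trace_prod (lists_len N) (local_A M) (tensor_pow N \<rho>))" if "\<rho> \<in> Pyes" for \<rho>
  proof -
    have "pure_state \<rho>" using pure that unfolding pure_property_def by blast
    then obtain X where "\<rho> = pstate X" by (rule pure_state_pstate)
    thus ?thesis using W that by (simp add: trA twirl_candidate_def Let_def S_def L_def)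
  qed
  moreover have "Re (trace_prod (lists_len N) (local_A M) (tensor_pow N \<rho>)) \<le> s" if "\<rho> \<in> Pno" for \<rho>
  proof -
    have "pure_state \<rho>" using pure that unfolding pure_property_def by blast
    then obtain X where "\<rho> = pstate X" by (rule pure_state_pstate)
    thus ?thesis using W that by (simp add: trA twirl_candidate_def Let_def S_def L_def)
  qed
  ultimately have "is_tester c s N Pyes Pno (local_A M)" by (simp add: is_tester_def)
  with M[unfolded L_def] show thesis by (rule that)
qed

theorem theorem1p1:
  fixes Pyes Pno :: "('d::finite \<times> 'd \<Rightarrow> 'd \<times> 'd \<Rightarrow> complex) set"
    and c s :: real
  assumes "pure_property Pyes Pno"
    and "unitarily_invariant_B Pyes Pno"
    and "0 \<le> s" and "s < c" and "c \<le> 1"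
  shows "(\<forall>N T. N \<ge> 1 \<longrightarrow> is_tester c s N Pyes Pno T \<longrightarrow>
            (\<exists>M :: 'd list \<Rightarrow> 'd list \<Rightarrow> complex.
               op_between_0_I (lists_len N) M \<and> is_tester c s N Pyes Pno (local_A M)))
       \<and> ((\<exists>N T. N \<ge> 1 \<and> is_tester c s N Pyes Pno T) \<longrightarrow>
            (\<exists>M :: 'd list \<Rightarrow> 'd list \<Rightarrow> complex.
               op_between_0_I (lists_len (sample_complexity c s Pyes Pno)) M \<and>
               is_tester c s (sample_complexity c s Pyes Pno) Pyes Pno (local_A M)))"
proof -
  have loc: "\<exists>M :: 'd list \<Rightarrow> 'd list \<Rightarrow> complex.
      op_between_0_I (lists_len N) M \<and> is_tester c s N Pyes Pno (local_A M)"
    if "is_tester c s N Pyes Pno T" for N T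
    using local_tester_exists[OF assms(1,2) that] by metis
  \<comment> \<open>The least admissible sample number is attained, so the first claim applies to
    it.\<close>
  have "\<exists>T. is_tester c s (sample_complexity c s Pyes Pno) Pyes Pno T"
    if "\<exists>N T. N \<ge> 1 \<and> is_tester c s N Pyes Pno T"
    using LeastI_ex[of "\<lambda>N. N \<ge> 1 \<and> (\<exists>T. is_tester c s N Pyes Pno T)"] that
    unfolding sample_complexity_def by blast
  with loc show ?thesis by blast
qed

end
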